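(* Let $X$ be a complex Banach space and let $T\in C(X)$ be such that $0\in\rho_e^r(T)$. Then $$\operatorname{dist}(0,\sigma_g(T))=\sup\Big\{\frac{1}{r(S)} : S\in B(X),\ \operatorname{ran}(S)\subseteq D(T),\ TST=T \text{ on } D(T)\Big\},$$ where $r(S)$ denotes the spectral radius of $S$.
   Context: $X$ is a complex Banach space, $C(X)$ is the set of closed, densely defined linear operators $T: D(T)\subseteq X\to X$, and $B(X)$ is the algebra of bounded linear operators on $X$. $\ker(T)$, $\operatorname{ran}(T)$, $D(T)$ denote kernel, range and domain; $I$ is the identity. A generalized inverse of $T\in C(X)$ is an operator $S\in B(X)$ with $\operatorname{ran}(S)\subseteq D(T)$ such that $TST=T$ on $D(T)$, $STS=S$ on $X$, and $ST$ (defined on $D(T)$) is continuous. $\operatorname{reg}(T)$ is the set of all $\lambda\in\mathbb{C}$ for which there exist a neighborhood $V$ of $\lambda$ and an analytic function $R:V\to B(X)$ such that $R(\mu)$ is a generalized inverse of $T-\mu I$ for every $\mu\in V$. The generalized spectrum is $\sigma_g(T)=\mathbb{C}\setminus\operatorname{reg}(T)$. $T\in C(X)$ is Fredholm if $\operatorname{ran}(T)$ is closed and both $\dim\ker(T)$ and $\operatorname{codim}\operatorname{ran}(T)$ are finite. $\rho_e(T)=\{\lambda\in\mathbb{C}: T-\lambda I \text{ is Fredholm}\}$ and $\rho_e^r(T)=\rho_e(T)\cap\operatorname{reg}(T)$. Conventions: $1/0=\infty$ and $\operatorname{dist}(0,\emptyset)=\infty$; the common value may be $\infty$. *)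

theory Defs
  imports "HOL-Analysis.Analysis"
begin

section \<open>Complex Banach spaces\<close>

class scaleC =
  fixes scaleC :: "complex \<Rightarrow> 'a \<Rightarrow> 'a"  (infixr "*\<^sub>C" 75)

class complex_normed_vector = real_normed_vector + scaleC +
  assumes scaleC_add_right: "c *\<^sub>C (x + y) = c *\<^sub>C x + c *\<^sub>C y"
    and scaleC_add_left: "(c + d) *\<^sub>C x = c *\<^sub>C x + d *\<^sub>C x"
    and scaleC_scaleC: "c *\<^sub>C d *\<^sub>C x = (c * d) *\<^sub>C x"
    and scaleC_one: "1 *\<^sub>C x = x"
    and scaleR_scaleC: "r *\<^sub>R x = complex_of_real r *\<^sub>C x"
    and norm_scaleC: "norm (c *\<^sub>C x) = cmod c * norm x"

class complex_banach = complex_normed_vector + banach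

global_interpretation complex_vector:
  vector_space "scaleC :: complex \<Rightarrow> 'a \<Rightarrow> 'a::complex_normed_vector"
  defines csubspace = complex_vector.subspace
    and cspan = complex_vector.span
  by unfold_locales (simp_all add: scaleC_add_right scaleC_add_left scaleC_scaleC scaleC_one)

lemma bounded_linear_scaleC: "bounded_linear (\<lambda>x::'a::complex_normed_vector. c *\<^sub>C x)"
  by (rule bounded_linear_intro[where K = "cmod c"])
    (simp_all add: scaleC_add_right scaleR_scaleC scaleC_scaleC norm_scaleC mult.commute)

instantiation blinfun :: (real_normed_vector, complex_normed_vector) complex_normed_vector
begin

lift_definition scaleC_blinfun :: "complex \<Rightarrow> ('a \<Rightarrow>\<^sub>L 'b) \<Rightarrow> ('a \<Rightarrow>\<^sub>L 'b)"
  is "\<lambda>c f x. c *\<^sub>C f x"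
  by (rule bounded_linear_compose[OF bounded_linear_scaleC])

instance
proof
  fix c d :: complex and r :: real and f g :: "'a \<Rightarrow>\<^sub>L 'b"
  show "c *\<^sub>C (f + g) = c *\<^sub>C f + c *\<^sub>C g"
    by transfer (simp add: scaleC_add_right)
  show "(c + d) *\<^sub>C f = c *\<^sub>C f + d *\<^sub>C f"
    by transfer (simp add: scaleC_add_left)
  show "c *\<^sub>C d *\<^sub>C f = (c * d) *\<^sub>C f"
    by transfer (simp add: scaleC_scaleC)
  show "1 *\<^sub>C f = f"
    by transfer simp
  show "r *\<^sub>R f = complex_of_real r *\<^sub>C f"
    by transfer (simp add: scaleR_scaleC)
  have le: "norm (a *\<^sub>C h) \<le> cmod a * norm h" for a and h :: "'a \<Rightarrow>\<^sub>L 'b"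
  proof (rule norm_blinfun_bound)
    show "norm (blinfun_apply (a *\<^sub>C h) x) \<le> cmod a * norm h * norm x" for x
      using mult_left_mono[OF norm_blinfun[of h x], of "cmod a"]
      by (simp add: scaleC_blinfun.rep_eq norm_scaleC mult.assoc)
  qed simp
  show "norm (c *\<^sub>C f) = cmod c * norm f"
  proof (cases "c = 0")
    case True
    then show ?thesis using le[of 0 f] by simp
  next
    case False
    have "f = inverse c *\<^sub>C c *\<^sub>C f"
      using False by transfer (simp add: scaleC_scaleC)
    then have "norm f \<le> cmod (inverse c) * norm (c *\<^sub>C f)"
      using le[of "inverse c" "c *\<^sub>C f"] by simp
    then have "cmod c * norm f \<le> norm (c *\<^sub>C f)"
      using False by (simp add: norm_inverse norm_divide field_simps)
    then show ?thesis using le[of c f] by simp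
  qed
qed

end

instance blinfun :: (real_normed_vector, complex_banach) complex_banach ..

text \<open>
  The library's \<open>holomorphic_on\<close> only covers scalar-valued functions. As there,
  analyticity on an open set is complex differentiability at each of its points.
\<close>

definition analytic_map :: "(complex \<Rightarrow> 'b::complex_normed_vector) \<Rightarrow> complex set \<Rightarrow> bool" where
  "analytic_map f V \<longleftrightarrow>
     (\<forall>\<mu>\<in>V. \<exists>d. (f has_derivative (\<lambda>h. h *\<^sub>C d)) (at \<mu>))"


section \<open>Bounded operators\<close>

text \<open>The type \<open>'a \<Rightarrow>\<^sub>L 'a\<close> consists of the real-linear bounded operators.\<close>

definition bounded_operators :: "('a::complex_normed_vector \<Rightarrow>\<^sub>L 'a) set" where
  "bounded_operators = {S. \<forall>c x. blinfun_apply S (c *\<^sub>C x) = c *\<^sub>C blinfun_apply S x}"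

definition op_spectrum :: "('a::complex_normed_vector \<Rightarrow>\<^sub>L 'a) \<Rightarrow> complex set" where
  "op_spectrum S = {z. \<not> (\<exists>R\<in>bounded_operators.
     R o\<^sub>L (S - z *\<^sub>C id_blinfun) = id_blinfun \<and>
     (S - z *\<^sub>C id_blinfun) o\<^sub>L R = id_blinfun)}"

text \<open>With values in \<^typ>\<open>ennreal\<close>, the spectral radius on the zero space is 0.\<close>

definition spectral_radius :: "('a::complex_normed_vector \<Rightarrow>\<^sub>L 'a) \<Rightarrow> ennreal" where
  "spectral_radius S = (SUP z\<in>op_spectrum S. ennreal (cmod z))"


section \<open>Unbounded operators\<close>

text \<open>
  An unbounded operator is a domain \<open>D\<close> together with a function \<open>T\<close>, whose
  values outside \<open>D\<close> are irrelevant.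
\<close>

definition closed_densely_defined ::
    "'a::complex_normed_vector set \<Rightarrow> ('a \<Rightarrow> 'a) \<Rightarrow> bool" where
  "closed_densely_defined D T \<longleftrightarrow>
     csubspace D \<and>
     (\<forall>x\<in>D. \<forall>y\<in>D. T (x + y) = T x + T y) \<and>
     (\<forall>c. \<forall>x\<in>D. T (c *\<^sub>C x) = c *\<^sub>C T x) \<and>
     closure D = UNIV \<and>
     closed {(x, T x) | x. x \<in> D}"

definition shift :: "('a::complex_normed_vector \<Rightarrow> 'a) \<Rightarrow> complex \<Rightarrow> 'a \<Rightarrow> 'a" where
  "shift T z = (\<lambda>x. T x - z *\<^sub>C x)"

definition generalized_inverse ::
    "'a::complex_normed_vector set \<Rightarrow> ('a \<Rightarrow> 'a) \<Rightarrow> ('a \<Rightarrow>\<^sub>L 'a) \<Rightarrow> bool" where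
  "generalized_inverse D T S \<longleftrightarrow>
     S \<in> bounded_operators \<and>
     range (blinfun_apply S) \<subseteq> D \<and>
     (\<forall>x\<in>D. T (blinfun_apply S (T x)) = T x) \<and>
     (\<forall>x. blinfun_apply S (T (blinfun_apply S x)) = blinfun_apply S x) \<and>
     continuous_on D (\<lambda>x. blinfun_apply S (T x))"

definition reg :: "'a::complex_normed_vector set \<Rightarrow> ('a \<Rightarrow> 'a) \<Rightarrow> complex set" where
  "reg D T = {z. \<exists>V R. open V \<and> z \<in> V \<and> analytic_map R V \<and>
     (\<forall>\<mu>\<in>V. generalized_inverse D (shift T \<mu>) (R \<mu>))}"

definition generalized_spectrum ::
    "'a::complex_normed_vector set \<Rightarrow> ('a \<Rightarrow> 'a) \<Rightarrow> complex set" where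
  "generalized_spectrum D T = - reg D T"

text \<open>
  \<open>complex_vector.dim\<close> is 0 for infinite-dimensional spaces, so finiteness of the
  dimension is expressed by finite spanning sets.
\<close>

definition finite_dim :: "'a::complex_normed_vector set \<Rightarrow> bool" where
  "finite_dim M \<longleftrightarrow> (\<exists>B. finite B \<and> cspan B = M)"

text \<open>The cosets of the elements of a finite set span the quotient by \<open>M\<close>.\<close>

definition finite_codim :: "'a::complex_normed_vector set \<Rightarrow> bool" where
  "finite_codim M \<longleftrightarrow> (\<exists>B. finite B \<and> (\<forall>x. \<exists>b\<in>cspan B. x - b \<in> M))"

definition fredholm :: "'a::complex_normed_vector set \<Rightarrow> ('a \<Rightarrow> 'a) \<Rightarrow> bool" where
  "fredholm D T \<longleftrightarrow>
     closed_densely_defined D T \<and>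
     closed (T ` D) \<and> finite_dim {x \<in> D. T x = 0} \<and> finite_codim (T ` D)"

definition rho_e :: "'a::complex_normed_vector set \<Rightarrow> ('a \<Rightarrow> 'a) \<Rightarrow> complex set" where
  "rho_e D T = {z. fredholm D (shift T z)}"

definition rho_e_r :: "'a::complex_normed_vector set \<Rightarrow> ('a \<Rightarrow> 'a) \<Rightarrow> complex set" where
  "rho_e_r D T = rho_e D T \<inter> reg D T"


section \<open>Distance to a set\<close>

text \<open>Unlike \<^const>\<open>infdist\<close>, the distance to the empty set is infinite.\<close>

definition dist_to_set :: "'a::metric_space \<Rightarrow> 'a set \<Rightarrow> ennreal" where
  "dist_to_set x A = (INF y\<in>A. ennreal (dist x y))"

end

theory Submission
  imports Defs
begin

text \<open>
  If \<open>S\<close> is an inner inverse of \<open>T\<close> and \<open>V l = (I - l S)^-1\<close> exists for \<open>|l| < \<rho>\<close>, then \<open>S V l\<close> is an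
  analytic inner inverse of \<open>T - l\<close>: regularity at \<open>0\<close> puts \<open>ker T\<close> into all ranges of powers of \<open>T\<close>,
  and this makes \<open>V l\<close> map \<open>ker T\<close> into \<open>ker (T - l)\<close>. A correction by the bounded projection onto
  \<open>ker T\<close> turns it into a generalized inverse, so the disc of radius \<open>1 / r(S)\<close> is regular.

  Conversely, if a slightly larger disc is regular, one looks for a subspace \<open>D'\<close> of the domain and a
  finite-dimensional \<open>N\<close> that are complements of \<open>ker (T - l)\<close> and \<open>ran (T - l)\<close> simultaneously for all
  \<open>l\<close> in the disc; then \<open>S (T x + n) = x\<close> (\<open>x \<in> D'\<close>, \<open>n \<in> N\<close>) has no spectrum outside the reciprocal disc.
  Functionals cutting out \<open>D'\<close> and vectors spanning \<open>N\<close> are added one at a time. A functional is bad at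
  \<open>l\<close> if it vanishes on the remaining kernel; if it is bad at \<open>l\<close>, it can be divided by \<open>T - l\<close>, and
  likewise a vector in the range can be replaced by a preimage. Repeating this either makes it good
  at \<open>l\<close> without changing its status elsewhere, or shows that it is bad near \<open>l\<close>. By connectedness the bad
  points in a compact disc are finite in number and can be removed.
\<close>

section \<open>Good parameters on compact sets\<close>

text \<open>Both \<open>P\<close> and its negation persist near each point of \<open>U\<close>, so
  \<open>P\<close> cuts out a relatively clopen subset of the connected set
  \<open>U\<close>.\<close>

lemma connected_eventually_induct:
  fixes P :: "'a::topological_space \<Rightarrow> bool"
  assumes U: "connected U" and a: "a \<in> U" "P a" and b: "b \<in> U"
    and true: "\<And>l. l \<in> U \<Longrightarrow> P l \<Longrightarrow> \<forall>\<^sub>F m in nhds l. m \<in> U \<longrightarrow> P m"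
    and false: "\<And>l. l \<in> U \<Longrightarrow> \<not> P l \<Longrightarrow> \<forall>\<^sub>F m in nhds l. m \<in> U \<longrightarrow> \<not> P m"
  shows "P b"
proof (rule connected_induction_simple[where P = P, OF U a(1) b a(2)])
  fix l assume l: "l \<in> U"
  show "\<exists>V. openin (top_of_set U) V \<and> l \<in> V \<and> (\<forall>x\<in>V. \<forall>y\<in>V. P x \<longrightarrow> P y)"
  proof (cases "P l")
    case True
    then obtain S where "open S" "l \<in> S" "\<forall>m\<in>S. m \<in> U \<longrightarrow> P m"
      using true[OF l] by (auto simp: eventually_nhds)
    with l show ?thesis by (intro exI[of _ "U \<inter> S"]) auto
  next
    case False
    then obtain S where "open S" "l \<in> S" "\<forall>m\<in>S. m \<in> U \<longrightarrow> \<not> P m"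
      using false[OF l] by (auto simp: eventually_nhds)
    with l show ?thesis by (intro exI[of _ "U \<inter> S"]) auto
  qed
qed

text \<open>If \<open>v\<close> is good somewhere in \<open>U\<close>, its bad points are isolated,
  so only finitely many lie in \<open>K\<close>; each is repaired by the second alternative of
  \<open>dich\<close> without creating another. Applied below to functionals and to vectors.\<close>

lemma good_on_compact:
  fixes good :: "'v \<Rightarrow> 'p::{first_countable_topology, perfect_space, t2_space} \<Rightarrow> bool"
  assumes U: "open U" "connected U" and K: "compact K" "K \<subseteq> U"
    and opn: "\<And>v l. P v \<Longrightarrow> l \<in> U \<Longrightarrow> good v l \<Longrightarrow> \<forall>\<^sub>F m in nhds l. good v m"
    and dich: "\<And>v l. P v \<Longrightarrow> l \<in> U \<Longrightarrow> (\<forall>\<^sub>F m in nhds l. \<not> good v m) \<or>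
         (\<exists>w. P w \<and> good w l \<and> (\<forall>m\<in>U - {l}. good w m \<longleftrightarrow> good v m))"
    and start: "P v" "a \<in> U" "good v a"
  shows "\<exists>w. P w \<and> (\<forall>l\<in>K. good w l)"
proof -
  \<comment> \<open>Goodness may fail at single points, so what is propagated along \<open>U\<close>
    is goodness on a punctured neighbourhood.\<close>
  have isolated: "\<forall>\<^sub>F m in at l. good v m" if v: "P v" "a \<in> U" "good v a" and l: "l \<in> U" for v a l
  proof (rule connected_eventually_induct[OF U(2) v(2) _ l])
    show "\<forall>\<^sub>F m in at a. good v m"
      using opn[OF v] by (rule filter_leD[rotated]) (simp add: at_within_le_nhds)
  next
    fix l assume "l \<in> U" and *: "\<forall>\<^sub>F m in at l. good v m"
    then obtain S where S: "open S" "l \<in> S" "\<forall>m\<in>S. m \<noteq> l \<longrightarrow> good v m"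
      by (auto simp: eventually_at_topological)
    have "\<forall>\<^sub>F x in at m. good v x" if "m \<in> S" for m
    proof (cases "m = l")
      case False
      then show ?thesis
        using S that unfolding eventually_at_topological
        by (intro exI[of _ "S - {l}"]) auto
    qed (simp add: *)
    then show "\<forall>\<^sub>F m in nhds l. m \<in> U \<longrightarrow> (\<forall>\<^sub>F x in at m. good v x)"
      using S by (auto simp: eventually_nhds)
  next
    fix l assume l: "l \<in> U" and *: "\<not> (\<forall>\<^sub>F m in at l. good v m)"
    have "\<forall>\<^sub>F m in nhds l. \<not> good v m"
    proof (rule ccontr)
      \<comment> \<open>Then \<open>dich\<close> supplies \<open>w\<close> good at \<open>l\<close>,
        hence near \<open>l\<close>; as \<open>w\<close> and \<open>v\<close> have the same status
        off \<open>l\<close>, \<open>v\<close> is good on a punctured neighbourhood, against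
        \<open>*\<close>.\<close>
      assume "\<not> ?thesis"
      then obtain w where w: "P w" "good w l" "\<forall>m\<in>U - {l}. good w m \<longleftrightarrow> good v m"
        using dich[OF v(1) l] by auto
      have "\<forall>\<^sub>F m in at l. good w m"
        using opn[OF w(1) l w(2)] by (rule filter_leD[rotated]) (simp add: at_within_le_nhds)
      moreover have "\<forall>\<^sub>F m in at l. m \<in> U - {l}"
        using U(1) l by (auto simp: eventually_at_topological)
      ultimately have "\<forall>\<^sub>F m in at l. good v m"
        by eventually_elim (use w in auto)
      with * show False by simp
    qed
    then obtain S where S: "open S" "l \<in> S" "\<forall>m\<in>S. \<not> good v m"
      by (auto simp: eventually_nhds)
    have "\<not> (\<forall>\<^sub>F x in at m. good v x)" if "m \<in> S" for m
    proof
      assume "\<forall>\<^sub>F x in at m. good v x"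
      moreover have "\<forall>\<^sub>F x in at m. \<not> good v x"
        using S that by (auto simp: eventually_at_topological)
      ultimately have "\<forall>\<^sub>F x in at m. False" by eventually_elim simp
      then show False by simp
    qed
    then show "\<forall>\<^sub>F m in nhds l. m \<in> U \<longrightarrow> \<not> (\<forall>\<^sub>F x in at m. good v x)"
      using S by (auto simp: eventually_nhds)
  qed
  have finite: "finite {l\<in>K. \<not> good v l}" if v: "P v" "a \<in> U" "good v a" for v a
  proof (rule ccontr)
    assume "infinite {l\<in>K. \<not> good v l}"
    then obtain l where l: "l \<in> K" "l islimpt {l\<in>K. \<not> good v l}"
      using K(1) Heine_Borel_imp_Bolzano_Weierstrass[of K "{l\<in>K. \<not> good v l}"] by auto
    then have "\<forall>\<^sub>F m in at l. good v m" using isolated[OF v] K by auto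
    then obtain S where "open S" "l \<in> S" "\<forall>m\<in>S. m \<noteq> l \<longrightarrow> good v m"
      by (auto simp: eventually_at_topological)
    with l show False unfolding islimpt_def by blast
  qed
  show ?thesis
    using start
  proof (induction "card {l\<in>K. \<not> good v l}" arbitrary: v a rule: less_induct)
    case less
    show ?case
    proof (cases "\<forall>l\<in>K. good v l")
      case False
      then obtain l where l: "l \<in> K" "\<not> good v l" by auto
      have "\<not> (\<forall>\<^sub>F m in nhds l. \<not> good v m)"
      proof
        assume "\<forall>\<^sub>F m in nhds l. \<not> good v m"
        then have "\<forall>\<^sub>F m in at l. \<not> good v m"
          by (rule filter_leD[rotated]) (simp add: at_within_le_nhds)
        moreover have "\<forall>\<^sub>F m in at l. good v m" using isolated less l K by blast
        ultimately have "\<forall>\<^sub>F m in at l. False" by eventually_elim simp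
        then show False by simp
      qed
      then obtain w where w: "P w" "good w l" "\<forall>m\<in>U - {l}. good w m \<longleftrightarrow> good v m"
        using dich[OF less.prems(1), of l] l K by auto
      have "{l\<in>K. \<not> good w l} \<subset> {l\<in>K. \<not> good v l}" using w l K by blast
      then have "card {l\<in>K. \<not> good w l} < card {l\<in>K. \<not> good v l}"
        by (rule psubset_card_mono[OF finite[OF less.prems]])
      \<comment> \<open>\<open>w\<close> is good at \<open>l\<close>, so \<open>l\<close> takes over
        the role of the starting point \<open>a\<close>.\<close>
      then show ?thesis using less.hyps[of w l] w l K by auto
    qed (use less in auto)
  qed
qed

section \<open>Closed and finite-dimensional subspaces\<close>

lemma bounded_bilinear_scaleC:
  "bounded_bilinear (\<lambda>c (x::'a::complex_normed_vector). c *\<^sub>C x)"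
  by (rule bounded_bilinear.intro, simp_all add: scaleC_add_right scaleC_add_left scaleR_scaleC scaleC_scaleC mult.commute)
    (auto simp: norm_scaleC scaleR_conv_of_real intro!: exI[of _ 1])

lemmas tendsto_scaleC = bounded_bilinear.tendsto[OF bounded_bilinear_scaleC]

text \<open>A ball around \<open>v\<close> misses the closed set \<open>F\<close>; homogeneity turns
  its radius into a bound on the coefficient of \<open>v\<close>.\<close>

lemma closed_csubspace_dist:
  fixes v :: "'a::complex_normed_vector"
  assumes F: "closed F" "csubspace F" and v: "v \<notin> F"
  obtains d where "d > 0" "\<And>f c. f \<in> F \<Longrightarrow> cmod c * d \<le> norm (f + c *\<^sub>C v)"
proof -
  obtain d where d: "d > 0" "ball v d \<subseteq> - F"
    using F(1) v by (meson ComplI open_Compl open_contains_ball)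
  have "cmod c * d \<le> norm (f + c *\<^sub>C v)" if f: "f \<in> F" for f c
  proof (cases "c = 0")
    case False
    have "- inverse c *\<^sub>C f \<in> F" using F(2) f by (rule complex_vector.subspace_scale)
    then have "- inverse c *\<^sub>C f \<notin> ball v d" using d by blast
    then have "d \<le> norm (v + inverse c *\<^sub>C f)" by (simp add: dist_norm)
    then have "cmod c * d \<le> norm (c *\<^sub>C (v + inverse c *\<^sub>C f))"
      by (simp add: norm_scaleC mult_left_mono)
    also have "c *\<^sub>C (v + inverse c *\<^sub>C f) = f + c *\<^sub>C v"
      using False by (simp add: scaleC_add_right scaleC_scaleC scaleC_one add.commute)
    finally show ?thesis .
  qed simp
  with d that show thesis by blast
qed

text \<open>For \<open>v\<close> outside \<open>F\<close> the coefficient of \<open>v\<close>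
  depends boundedly on the sum, so along a convergent sequence the coefficients are Cauchy, and the
  components in \<open>F\<close> converge as well.\<close>

lemma closed_csubspace_plus_line:
  fixes v :: "'a::complex_banach"
  assumes F: "closed F" "csubspace F"
  shows "closed {f + c *\<^sub>C v | f c. f \<in> F}"
proof (cases "v \<in> F")
  case True
  then have "{f + c *\<^sub>C v | f c. f \<in> F} = F"
  proof safe
    fix f c assume "f \<in> F"
    then show "f + c *\<^sub>C v \<in> F"
      using F(2) True by (intro complex_vector.subspace_add complex_vector.subspace_scale)
  next
    fix f assume "f \<in> F"
    then show "\<exists>g c. f = g + c *\<^sub>C v \<and> g \<in> F" by (intro exI[of _ f] exI[of _ 0]) simp
  qed
  with F show ?thesis by simp
next
  case False
  obtain d where d: "d > 0" "\<And>f c. f \<in> F \<Longrightarrow> cmod c * d \<le> norm (f + c *\<^sub>C v)"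
    using closed_csubspace_dist[OF F False] by metis
  show ?thesis
    unfolding closed_sequential_limits
  proof safe
    fix x l assume "\<forall>n. x n \<in> {f + c *\<^sub>C v | f c. f \<in> F}" and lim: "x \<longlonglongrightarrow> l"
    then obtain f c where fc: "\<And>n. x n = f n + c n *\<^sub>C v" "\<And>n. f n \<in> F" by auto metis
    have *: "dist (c m) (c n) \<le> dist (x m) (x n) / d" for m n
    proof -
      have eq: "x m - x n = (f m - f n) + (c m - c n) *\<^sub>C v"
        by (simp add: fc complex_vector.scale_left_diff_distrib)
      have "f m - f n \<in> F" using F fc complex_vector.subspace_diff by blast
      then have "cmod (c m - c n) * d \<le> norm (x m - x n)" unfolding eq by (rule d(2))
      then show ?thesis using d(1) by (simp add: dist_norm pos_le_divide_eq)
    qed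
    have "Cauchy x" using lim by (rule LIMSEQ_imp_Cauchy)
    have "Cauchy c"
    proof (rule metric_CauchyI)
      fix e :: real assume "e > 0"
      then obtain M where "\<forall>m\<ge>M. \<forall>n\<ge>M. dist (x m) (x n) < e * d"
        using metric_CauchyD[OF \<open>Cauchy x\<close>, of "e * d"] d(1) by auto
      then have "\<forall>m\<ge>M. \<forall>n\<ge>M. dist (x m) (x n) / d < e" using d(1) by (simp add: field_simps)
      then show "\<exists>M. \<forall>m\<ge>M. \<forall>n\<ge>M. dist (c m) (c n) < e" using * by (meson le_less_trans)
    qed
    then obtain k where k: "c \<longlonglongrightarrow> k" using Cauchy_convergent convergent_def by blast
    have "(\<lambda>n. x n - c n *\<^sub>C v) \<longlonglongrightarrow> l - k *\<^sub>C v" by (intro tendsto_diff lim tendsto_scaleC k tendsto_const)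
    then have "l - k *\<^sub>C v \<in> F" using F(1) fc by (auto simp: closed_sequential_limits)
    then show "\<exists>f c. l = f + c *\<^sub>C v \<and> f \<in> F" by (intro exI[of _ "l - k *\<^sub>C v"] exI[of _ k]) simp
  qed
qed

lemma closed_cspan_finite:
  fixes B :: "'a::complex_banach set"
  assumes "finite B"
  shows "closed (cspan B)"
  using assms
proof induction
  case (insert b B)
  have "cspan (insert b B) = {f + c *\<^sub>C b | f c. f \<in> cspan B}"
  proof safe
    fix x assume "x \<in> cspan (insert b B)"
    then obtain c where "x - c *\<^sub>C b \<in> cspan B" by (auto simp: complex_vector.span_insert)
    then show "\<exists>f c. x = f + c *\<^sub>C b \<and> f \<in> cspan B"
      by (intro exI[of _ "x - c *\<^sub>C b"] exI[of _ c]) simp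
  next
    fix f c assume "f \<in> cspan B"
    then show "f + c *\<^sub>C b \<in> cspan (insert b B)"
      by (auto simp: complex_vector.span_insert intro!: exI[of _ c])
  qed
  then show ?case using closed_csubspace_plus_line[OF insert.IH] by simp
qed simp

section \<open>Complements of the kernels\<close>

lemma bounded_operators_scaleC:
  "S \<in> bounded_operators \<Longrightarrow> blinfun_apply S (c *\<^sub>C x) = c *\<^sub>C blinfun_apply S x"
  by (simp add: bounded_operators_def)

lemma shift_eq: "shift T m x = shift T l x + (l - m) *\<^sub>C x"
  by (simp add: shift_def complex_vector.scale_left_diff_distrib)

lemma shift_0 [simp]: "shift T 0 = T"
  by (auto simp: shift_def)

lemma geometric_bound_imp_zero:
  fixes x :: "'a::real_normed_vector"
  assumes "\<And>j. norm x \<le> K * q ^ j" "0 \<le> q" "q < 1"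
  shows "x = 0"
proof -
  have "(\<lambda>j. K * q ^ j) \<longlonglongrightarrow> K * 0"
    using assms by (intro tendsto_mult tendsto_const LIMSEQ_power_zero) auto
  then have "norm x \<le> K * 0"
    by (rule tendsto_lowerbound) (use assms in auto)
  then show ?thesis by simp
qed

lemma eventually_dist_small:
  fixes l :: complex
  assumes "e > 0"
  shows "\<forall>\<^sub>F m in nhds l. cmod (m - l) * K < e"
proof -
  have "((\<lambda>m. cmod (m - l) * K) \<longlongrightarrow> cmod (l - l) * K) (nhds l)"
    by (intro tendsto_intros filterlim_ident)
  then show ?thesis using assms by (intro order_tendstoD(2)) auto
qed

section \<open>Closed operators, inner inverses and functionals on the domain\<close>

locale closed_operator =
  fixes D :: "'a::complex_banach set" and T :: "'a \<Rightarrow> 'a"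
  assumes cdd: "closed_densely_defined D T"
begin

lemma D_subspace: "csubspace D"
  using cdd by (simp add: closed_densely_defined_def)

lemma shift_add: "x \<in> D \<Longrightarrow> y \<in> D \<Longrightarrow> shift T m (x + y) = shift T m x + shift T m y"
  using cdd by (simp add: closed_densely_defined_def shift_def scaleC_add_right)

lemma shift_scale: "x \<in> D \<Longrightarrow> shift T m (c *\<^sub>C x) = c *\<^sub>C shift T m x"
  using cdd by (simp add: closed_densely_defined_def shift_def scaleC_scaleC
      complex_vector.scale_right_diff_distrib mult.commute)

lemma shift_zero [simp]: "shift T m 0 = 0"
  using shift_scale[of 0 m 0] complex_vector.subspace_0[OF D_subspace] by simp

lemma shift_diff:
  assumes "x \<in> D" "y \<in> D"
  shows "shift T m (x - y) = shift T m x - shift T m y"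
  using shift_add[of "x - y" y m] assms complex_vector.subspace_diff[OF D_subspace] by simp

text \<open>Adding \<open>m *\<^sub>C x n\<close> recovers \<open>T (x n)\<close>, so closedness of
  the graph passes from \<open>T\<close> to \<open>T - m\<close>.\<close>

lemma shift_closed:
  assumes "\<And>n. x n \<in> D" "x \<longlonglongrightarrow> l" "(\<lambda>n. shift T m (x n)) \<longlonglongrightarrow> z"
  shows "l \<in> D" "shift T m l = z"
proof -
  have "(\<lambda>n. shift T m (x n) + m *\<^sub>C x n) \<longlonglongrightarrow> z + m *\<^sub>C l"
    by (intro tendsto_add tendsto_scaleC assms tendsto_const)
  then have lim: "(\<lambda>n. (x n, T (x n))) \<longlonglongrightarrow> (l, z + m *\<^sub>C l)"
    by (intro tendsto_Pair assms) (simp add: shift_def)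
  have "closed {(x, T x) | x. x \<in> D}"
    using cdd by (simp add: closed_densely_defined_def)
  then have "(l, z + m *\<^sub>C l) \<in> {(x, T x) | x. x \<in> D}"
    by (rule closed_sequentially[OF _ _ lim]) (use assms(1) in auto)
  then have "l \<in> D" "T l = z + m *\<^sub>C l" by auto
  then show "l \<in> D" "shift T m l = z" by (simp_all add: shift_def)
qed

text \<open>At \<open>m = 0\<close> these are exactly the operators over which the supremum of the
  theorem runs.\<close>

definition inner_inverse :: "complex \<Rightarrow> ('a \<Rightarrow>\<^sub>L 'a) \<Rightarrow> bool" where
  "inner_inverse m S \<longleftrightarrow> S \<in> bounded_operators \<and> range (blinfun_apply S) \<subseteq> D \<and>
     (\<forall>x\<in>D. shift T m (S (shift T m x)) = shift T m x)"

lemma inner_inverse_diff_kernel: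
  assumes "inner_inverse m S" "x \<in> D"
  shows "shift T m (x - S (shift T m x)) = 0"
  using assms by (subst shift_diff) (auto simp: inner_inverse_def)

text \<open>Values of \<open>S\<close> in \<open>D'\<close> mean that \<open>T - m\<close> attains
  its whole range already on \<open>D'\<close>. The local bound on the norms stands in for a
  continuous choice of \<open>S\<close>.\<close>

definition inner_inverses_into :: "'a set \<Rightarrow> real \<Rightarrow> bool" where
  "inner_inverses_into D' \<rho> \<longleftrightarrow> csubspace D' \<and> D' \<subseteq> D \<and>
     (\<forall>l\<in>ball 0 \<rho>. \<exists>C. \<forall>\<^sub>F m in nhds l. \<exists>S. inner_inverse m S \<and>
        range (blinfun_apply S) \<subseteq> D' \<and> norm S \<le> C)"

text \<open>Boundedness on \<open>D\<close> in the norm of the space suffices, which avoids extending functionals.\<close>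

definition functional :: "('a \<Rightarrow> complex) \<Rightarrow> bool" where
  "functional \<phi> \<longleftrightarrow> (\<forall>x\<in>D. \<forall>y\<in>D. \<phi> (x + y) = \<phi> x + \<phi> y) \<and>
     (\<forall>c. \<forall>x\<in>D. \<phi> (c *\<^sub>C x) = c * \<phi> x) \<and> (\<exists>C. \<forall>x\<in>D. cmod (\<phi> x) \<le> C * norm x)"

lemma functional_bound:
  assumes "functional \<phi>"
  obtains C where "C > 0" "\<And>x. x \<in> D \<Longrightarrow> cmod (\<phi> x) \<le> C * norm x"
proof -
  obtain C where C: "\<And>x. x \<in> D \<Longrightarrow> cmod (\<phi> x) \<le> C * norm x"
    using assms unfolding functional_def by blast
  have "cmod (\<phi> x) \<le> max C 1 * norm x" if "x \<in> D" for x
    using C[OF that] mult_right_mono[of C "max C 1" "norm x"] by simp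
  then show thesis using that[of "max C 1"] by simp
qed

lemma functional_add: "functional \<phi> \<Longrightarrow> x \<in> D \<Longrightarrow> y \<in> D \<Longrightarrow> \<phi> (x + y) = \<phi> x + \<phi> y"
  by (simp add: functional_def)

lemma functional_scale: "functional \<phi> \<Longrightarrow> x \<in> D \<Longrightarrow> \<phi> (c *\<^sub>C x) = c * \<phi> x"
  by (simp add: functional_def)

lemma functional_diff: "functional \<phi> \<Longrightarrow> x \<in> D \<Longrightarrow> y \<in> D \<Longrightarrow> \<phi> (x - y) = \<phi> x - \<phi> y"
  using complex_vector.subspace_diff[OF D_subspace, of x y] unfolding functional_def
  by (metis add_diff_cancel_right' diff_add_cancel)

lemma functional_compose:
  assumes "functional \<phi>" "S \<in> bounded_operators" "range (blinfun_apply S) \<subseteq> D"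
  shows "functional (\<lambda>x. \<phi> (S x))"
proof -
  obtain C where C: "C > 0" "\<And>x. x \<in> D \<Longrightarrow> cmod (\<phi> x) \<le> C * norm x"
    using functional_bound[OF assms(1)] by metis
  have "cmod (\<phi> (S x)) \<le> C * norm S * norm x" for x
  proof -
    have "cmod (\<phi> (S x)) \<le> C * norm (S x)" using assms(3) by (intro C) auto
    also have "\<dots> \<le> C * (norm S * norm x)" using C by (intro mult_left_mono norm_blinfun) auto
    finally show ?thesis by (simp add: mult.assoc)
  qed
  then show ?thesis
    using assms unfolding functional_def
    by (auto simp: blinfun.add_right bounded_operators_scaleC image_subset_iff)
qed

text \<open>A vector \<open>y\<close> of the kernel at \<open>l\<close> is moved to
  \<open>y - S (T - m) y\<close>. Since \<open>(T - m) y = (l - m) y\<close> is small and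
  \<open>S\<close> is bounded near \<open>l\<close>, the result stays close to \<open>y\<close> and
  \<open>\<phi>\<close> stays away from zero on it, so that it can be normalised.\<close>

lemma local_kernel_section:
  assumes D': "inner_inverses_into D' \<rho>" and l: "l \<in> ball 0 \<rho>" and \<phi>: "functional \<phi>"
    and y: "y \<in> D'" "shift T l y = 0" "\<phi> y \<noteq> 0"
  shows "\<exists>C. \<forall>\<^sub>F m in nhds l. \<exists>y\<in>D'. shift T m y = 0 \<and> \<phi> y = 1 \<and> norm y \<le> C"
proof -
  have sub: "csubspace D'" "D' \<subseteq> D" using D' by (auto simp: inner_inverses_into_def)
  obtain C where C: "\<forall>\<^sub>F m in nhds l. \<exists>S. inner_inverse m S \<and>
        range (blinfun_apply S) \<subseteq> D' \<and> norm S \<le> C"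
    using D' l unfolding inner_inverses_into_def by blast
  obtain K where K: "K > 0" "\<And>x. x \<in> D \<Longrightarrow> cmod (\<phi> x) \<le> K * norm x"
    using functional_bound[OF \<phi>] by metis
  \<comment> \<open>The first bound gives \<open>norm z \<le> norm y + 1\<close>, the second keeps
    \<open>cmod (\<phi> z)\<close> above half of \<open>cmod (\<phi> y)\<close>; the quotient bounds
    the normalised vector.\<close>
  have "\<forall>\<^sub>F m in nhds l. cmod (m - l) * (C * norm y) < 1"
    "\<forall>\<^sub>F m in nhds l. cmod (m - l) * (K * (C * norm y)) < cmod (\<phi> y) / 2"
    by (rule eventually_dist_small; use y in simp)+
  with C have "\<forall>\<^sub>F m in nhds l. \<exists>z\<in>D'. shift T m z = 0 \<and> \<phi> z = 1 \<and>
      norm z \<le> (norm y + 1) / (cmod (\<phi> y) / 2)"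
  proof eventually_elim
    case (elim m)
    then obtain S where S: "inner_inverse m S" "range (blinfun_apply S) \<subseteq> D'" "norm S \<le> C"
      by auto
    have S': "S u \<in> D'" "S u \<in> D" for u using S(2) sub(2) by auto
    define z where "z = y - S (shift T m y)"
    have Am: "shift T m y = (l - m) *\<^sub>C y" using shift_eq[of T m y l] y by simp
    have "norm (S ((l - m) *\<^sub>C y)) \<le> norm S * norm ((l - m) *\<^sub>C y)" by (rule norm_blinfun)
    also have "\<dots> \<le> C * norm ((l - m) *\<^sub>C y)" by (intro mult_right_mono S) auto
    also have "\<dots> = cmod (m - l) * (C * norm y)"
      by (simp add: norm_scaleC norm_minus_commute)
    finally have small: "norm (S ((l - m) *\<^sub>C y)) \<le> cmod (m - l) * (C * norm y)" .
    have z: "z \<in> D'" "z \<in> D"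
      using S' y sub complex_vector.subspace_diff[OF sub(1)] unfolding z_def by auto
    have "cmod (\<phi> (S ((l - m) *\<^sub>C y))) \<le> K * norm (S ((l - m) *\<^sub>C y))" using K S' by auto
    also have "\<dots> \<le> K * (cmod (m - l) * (C * norm y))" using small K by (intro mult_left_mono) auto
    also have "\<dots> < cmod (\<phi> y) / 2" using elim by (simp add: mult_ac)
    moreover have "\<phi> z = \<phi> y - \<phi> (S ((l - m) *\<^sub>C y))"
      unfolding z_def Am using \<phi> y sub S' by (intro functional_diff) auto
    moreover have "cmod (\<phi> y) \<le> cmod (\<phi> y - \<phi> (S ((l - m) *\<^sub>C y))) + cmod (\<phi> (S ((l - m) *\<^sub>C y)))"
      by (metis diff_add_cancel norm_triangle_ineq)
    ultimately have \<phi>z: "cmod (\<phi> z) > cmod (\<phi> y) / 2" by simp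
    then have nz: "\<phi> z \<noteq> 0" using y by auto
    have nz': "norm z \<le> norm y + 1"
      using norm_triangle_ineq4[of y "S ((l - m) *\<^sub>C y)"] small elim unfolding z_def Am by linarith
    have "norm (inverse (\<phi> z) *\<^sub>C z) = norm z / cmod (\<phi> z)"
      by (simp add: norm_scaleC norm_inverse divide_inverse)
    also have "\<dots> \<le> (norm y + 1) / (cmod (\<phi> y) / 2)"
      using \<phi>z nz' y by (intro frac_le) auto
    finally have "norm (inverse (\<phi> z) *\<^sub>C z) \<le> (norm y + 1) / (cmod (\<phi> y) / 2)" .
    moreover have "shift T m (inverse (\<phi> z) *\<^sub>C z) = 0"
      using inner_inverse_diff_kernel[OF S(1), of y] y sub z
      by (auto simp: z_def[symmetric] shift_scale)
    moreover have "\<phi> (inverse (\<phi> z) *\<^sub>C z) = 1"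
      using nz by (simp add: functional_scale[OF \<phi> z(2)])
    ultimately show ?case
      using complex_vector.subspace_scale[OF sub(1) z(1)] by blast
  qed
  then show ?thesis ..
qed

text \<open>
  With \<open>S\<close> an inner inverse at \<open>l\<close>, a functional \<open>\<phi>\<close> vanishing on \<open>ker (T - l) \<inter> D'\<close> satisfies
  \<open>\<phi> = (m - l) (\<phi> \<circ> S)\<close> on \<open>ker (T - m) \<inter> D'\<close>. If all \<open>\<phi> \<circ> S ^ j\<close> vanish at \<open>l\<close>, the resulting geometric
  bound forces \<open>\<phi> = 0\<close> on these kernels for \<open>m\<close> near \<open>l\<close>.
\<close>

lemma functional_removal:
  assumes D': "inner_inverses_into D' \<rho>" and l: "l \<in> ball 0 \<rho>" and \<phi>: "functional \<phi>"
  defines "good \<equiv> \<lambda>\<phi> m. \<exists>y\<in>D'. shift T m y = 0 \<and> \<phi> y \<noteq> (0::complex)"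
  shows "(\<forall>\<^sub>F m in nhds l. \<not> good \<phi> m) \<or>
    (\<exists>\<psi>. functional \<psi> \<and> good \<psi> l \<and> (\<forall>m\<in>ball 0 \<rho> - {l}. good \<psi> m \<longleftrightarrow> good \<phi> m))"
proof -
  have sub: "csubspace D'" "D' \<subseteq> D" using D' by (auto simp: inner_inverses_into_def)
  obtain C where "\<forall>\<^sub>F m in nhds l. \<exists>S. inner_inverse m S \<and>
        range (blinfun_apply S) \<subseteq> D' \<and> norm S \<le> C"
    using D' l unfolding inner_inverses_into_def by blast
  then obtain S where S: "inner_inverse l S" "range (blinfun_apply S) \<subseteq> D'"
    using eventually_nhds_x_imp_x by blast
  have S': "S u \<in> D'" "S u \<in> D" for u using S(2) sub(2) by auto
  \<comment> \<open>\<open>\<psi> j\<close> is \<open>\<phi>\<close> divided \<open>j\<close> times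
    by \<open>T - l\<close>, division being composition with \<open>S\<close>.\<close>
  define \<psi> where "\<psi> j x = \<phi> ((blinfun_apply S ^^ j) x)" for j x
  have \<psi>_0: "\<psi> 0 = \<phi>" and \<psi>_Suc: "\<psi> (Suc j) = (\<lambda>x. \<psi> j (S x))" for j
    by (auto simp: \<psi>_def funpow_swap1)
  have func: "functional (\<psi> j)" for j
    by (induction j) (use \<phi> S in \<open>auto simp: \<psi>_0 \<psi>_Suc inner_inverse_def intro!: functional_compose\<close>)
  obtain K where K: "K > 0" "\<And>x. x \<in> D \<Longrightarrow> cmod (\<phi> x) \<le> K * norm x"
    using functional_bound[OF \<phi>] by metis
  have bound: "cmod (\<psi> j x) \<le> K * norm S ^ j * norm x" if "x \<in> D" for j x
    using that
  proof (induction j arbitrary: x)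
    case (Suc j)
    have "cmod (\<psi> (Suc j) x) \<le> K * norm S ^ j * norm (S x)" using Suc.IH[OF S'(2)] by (simp add: \<psi>_Suc)
    also have "\<dots> \<le> K * norm S ^ j * (norm S * norm x)"
      using K by (intro mult_left_mono norm_blinfun) auto
    finally show ?case by (simp add: mult_ac)
  qed (use K in \<open>simp add: \<psi>_0\<close>)
  have step: "\<psi> j y = (m - l) * \<psi> (Suc j) y"
    if van: "\<And>y. y \<in> D' \<Longrightarrow> shift T l y = 0 \<Longrightarrow> \<psi> j y = 0" and y: "y \<in> D'" "shift T m y = 0" for j m y
  proof -
    have yD: "y \<in> D" using y sub by auto
    \<comment> \<open>This vector lies in the kernel at \<open>l\<close>, where
      \<open>\<psi> j\<close> vanishes by \<open>van\<close>.\<close>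
    have "y - S (shift T l y) \<in> D'" using y S' by (intro complex_vector.subspace_diff sub)
    then have "\<psi> j (y - S (shift T l y)) = 0"
      using van inner_inverse_diff_kernel[OF S(1) yD] by blast
    then have "\<psi> j y = \<psi> j (S (shift T l y))" using functional_diff[OF func yD S'(2)] by simp
    also have "shift T l y = (m - l) *\<^sub>C y" using shift_eq[of T l y m] y by simp
    also have "\<psi> j (S ((m - l) *\<^sub>C y)) = (m - l) * \<psi> j (S y)"
      using S func S' by (simp add: inner_inverse_def bounded_operators_scaleC functional_scale)
    finally show ?thesis by (simp add: \<psi>_Suc)
  qed
  have factor: "\<phi> y = (m - l) ^ j * \<psi> j y"
    if "\<And>i y. i < j \<Longrightarrow> y \<in> D' \<Longrightarrow> shift T l y = 0 \<Longrightarrow> \<psi> i y = 0"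
      and y: "y \<in> D'" "shift T m y = 0" for j m y
    using that(1)
  proof (induction j)
    case (Suc j)
    then have "\<phi> y = (m - l) ^ j * \<psi> j y" by simp
    also have "\<psi> j y = (m - l) * \<psi> (Suc j) y" using Suc.prems y by (intro step) auto
    finally show ?case by simp
  qed (simp add: \<psi>_0)
  show ?thesis
  proof (cases "\<exists>j. good (\<psi> j) l")
    case True
    \<comment> \<open>For the first \<open>j\<close> with \<open>\<psi> j\<close> good at
      \<open>l\<close>, \<open>factor\<close> applies: on the kernel at \<open>m \<noteq> l\<close>,
      \<open>\<phi>\<close> and \<open>\<psi> j\<close> differ by the nonzero factor
      \<open>(m - l) ^ j\<close>.\<close>
    define j where "j = (LEAST j. good (\<psi> j) l)"
    have j: "good (\<psi> j) l" unfolding j_def using True by (rule LeastI_ex)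
    have j': "\<not> good (\<psi> i) l" if "i < j" for i using that not_less_Least unfolding j_def by blast
    have "good (\<psi> j) m \<longleftrightarrow> good \<phi> m" if "m \<noteq> l" for m
    proof -
      have "\<phi> y = (m - l) ^ j * \<psi> j y" if "y \<in> D'" "shift T m y = 0" for y
        using j' that by (intro factor) (auto simp: good_def)
      then show ?thesis using \<open>m \<noteq> l\<close> by (auto simp: good_def)
    qed
    then show ?thesis using func j by blast
  next
    case False
    have "\<forall>\<^sub>F m in nhds l. cmod (m - l) * norm S < 1" by (rule eventually_dist_small) simp
    then have "\<forall>\<^sub>F m in nhds l. \<not> good \<phi> m"
    proof eventually_elim
      case (elim m)
      have "\<phi> y = 0" if y: "y \<in> D'" "shift T m y = 0" for y
      proof (rule geometric_bound_imp_zero[where K = "K * norm y" and q = "cmod (m - l) * norm S"])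
        fix j
        have "\<phi> y = (m - l) ^ j * \<psi> j y" using False y by (intro factor) (auto simp: good_def)
        then have "cmod (\<phi> y) = cmod (m - l) ^ j * cmod (\<psi> j y)" by (simp add: norm_mult norm_power)
        also have "\<dots> \<le> cmod (m - l) ^ j * (K * norm S ^ j * norm y)"
          using y sub by (intro mult_left_mono bound) auto
        finally show "cmod (\<phi> y) \<le> K * norm y * (cmod (m - l) * norm S) ^ j"
          by (simp add: power_mult_distrib mult_ac)
      qed (use elim in auto)
      then show ?case by (auto simp: good_def)
    qed
    then show ?thesis by simp
  qed
qed

text \<open>Let \<open>y\<close> be the normalised kernel section at \<open>m\<close>. Then
  \<open>S x - \<phi> (S x) y\<close> lies in the kernel of \<open>\<phi>\<close> and has the same
  image under \<open>T - m\<close> as \<open>S x\<close>. The sections are locally bounded, hence so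
  are the new inner inverses.\<close>

lemma inner_inverses_into_Int_kernel:
  assumes D': "inner_inverses_into D' \<rho>" and \<phi>: "functional \<phi>" and "\<rho>' \<le> \<rho>"
    and good: "\<And>l. l \<in> ball 0 \<rho>' \<Longrightarrow> \<exists>y\<in>D'. shift T l y = 0 \<and> \<phi> y \<noteq> 0"
  shows "inner_inverses_into {x \<in> D'. \<phi> x = 0} \<rho>'"
  unfolding inner_inverses_into_def
proof (intro conjI ballI)
  have sub: "csubspace D'" "D' \<subseteq> D" using D' by (auto simp: inner_inverses_into_def)
  show "{x \<in> D'. \<phi> x = 0} \<subseteq> D" using sub by auto
  have add: "\<phi> (x + y) = \<phi> x + \<phi> y" if "x \<in> D'" "y \<in> D'" for x y
    using \<phi> sub that by (intro functional_add) auto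
  have "\<phi> 0 = 0"
    using functional_scale[OF \<phi>, of 0 0] complex_vector.subspace_0[OF D_subspace] by simp
  then show "csubspace {x \<in> D'. \<phi> x = 0}"
    using sub functional_scale[OF \<phi>]
    by (intro complex_vector.subspaceI)
      (auto simp: add complex_vector.subspace_0 complex_vector.subspace_add complex_vector.subspace_scale)
  fix l :: complex assume l: "l \<in> ball 0 \<rho>'"
  then have l': "l \<in> ball 0 \<rho>" using assms(3) by auto
  obtain C where C: "\<forall>\<^sub>F m in nhds l. \<exists>S. inner_inverse m S \<and>
        range (blinfun_apply S) \<subseteq> D' \<and> norm S \<le> C"
    using D' l' unfolding inner_inverses_into_def by blast
  obtain M where M: "\<forall>\<^sub>F m in nhds l. \<exists>y\<in>D'. shift T m y = 0 \<and> \<phi> y = 1 \<and> norm y \<le> M"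
    using local_kernel_section[OF D' l' \<phi>] good[OF l] by blast
  obtain K where K: "K > 0" "\<And>x. x \<in> D \<Longrightarrow> cmod (\<phi> x) \<le> K * norm x"
    using functional_bound[OF \<phi>] by metis
  have "\<forall>\<^sub>F m in nhds l. \<exists>S. inner_inverse m S \<and>
        range (blinfun_apply S) \<subseteq> {x \<in> D'. \<phi> x = 0} \<and> norm S \<le> C + K * C * M"
    using C M
  proof eventually_elim
    case (elim m)
    then obtain S y where S: "inner_inverse m S" "range (blinfun_apply S) \<subseteq> D'" "norm S \<le> C"
      and y: "y \<in> D'" "shift T m y = 0" "\<phi> y = 1" "norm y \<le> M" by auto
    have S': "S u \<in> D'" "S u \<in> D" for u using S(2) sub(2) by auto
    have yD: "y \<in> D" using y sub by auto
    have \<phi>S: "cmod (\<phi> (S x)) \<le> K * C * norm x" for x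
    proof -
      have "cmod (\<phi> (S x)) \<le> K * norm (S x)" using K S' by blast
      also have "\<dots> \<le> K * (norm S * norm x)" using K by (intro mult_left_mono norm_blinfun) auto
      also have "\<dots> \<le> K * (C * norm x)" using K S by (intro mult_left_mono mult_right_mono) auto
      finally show ?thesis by (simp add: mult.assoc)
    qed
    define f where "f x = S x - \<phi> (S x) *\<^sub>C y" for x
    have fb: "norm (f x) \<le> (C + K * C * M) * norm x" for x
    proof -
      have "norm (f x) \<le> norm (S x) + cmod (\<phi> (S x)) * norm y"
        using norm_triangle_ineq4[of "S x" "\<phi> (S x) *\<^sub>C y"] by (simp add: f_def norm_scaleC)
      also have "norm (S x) \<le> C * norm x"
        using norm_blinfun[of S x] mult_right_mono[OF S(3), of "norm x"] by simp
      also have "cmod (\<phi> (S x)) * norm y \<le> (K * C * norm x) * M"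
        using order_trans[OF norm_ge_zero \<phi>S] by (intro mult_mono \<phi>S y) auto
      finally show ?thesis by (simp add: algebra_simps)
    qed
    have fs: "f (c *\<^sub>C x) = c *\<^sub>C f x" for c x
      using S \<phi> S' by (simp add: f_def inner_inverse_def bounded_operators_scaleC functional_scale
          complex_vector.scale_right_diff_distrib scaleC_scaleC)
    have fa: "f (x + z) = f x + f z" for x z
      using S' by (simp add: f_def blinfun.add_right add scaleC_add_left)
    have bl: "bounded_linear f"
      by (rule bounded_linear_intro[where K = "C + K * C * M"])
        (use fa fs fb in \<open>auto simp: scaleR_scaleC mult.commute\<close>)
    define B where "B = Blinfun f"
    have B: "blinfun_apply B = f" unfolding B_def by (rule bounded_linear_Blinfun_apply[OF bl])
    have "0 \<le> C" using S(3) norm_ge_zero order_trans by blast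
    moreover have "0 \<le> M" using y(4) norm_ge_zero order_trans by blast
    ultimately have "norm B \<le> C + K * C * M"
      using K by (intro norm_blinfun_bound) (auto simp: B fb)
    moreover have "range (blinfun_apply B) \<subseteq> {x \<in> D'. \<phi> x = 0}"
      using S' yD \<phi> sub y
      by (auto simp: B f_def functional_diff functional_scale complex_vector.subspace_scale[OF D_subspace]
          intro!: complex_vector.subspace_diff complex_vector.subspace_scale)
    moreover have "inner_inverse m B"
    proof -
      have "shift T m (f x) = shift T m (S x)" for x
        using S' yD y
        by (simp add: f_def shift_diff shift_scale complex_vector.subspace_scale[OF D_subspace])
      then show ?thesis
        using S(1) fs \<open>range (blinfun_apply B) \<subseteq> _\<close> sub
        by (auto simp: inner_inverse_def B bounded_operators_def)
    qed
    ultimately show ?case by blast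
  qed
  then show "\<exists>C. \<forall>\<^sub>F m in nhds l. \<exists>S. inner_inverse m S \<and>
        range (blinfun_apply S) \<subseteq> {x \<in> D'. \<phi> x = 0} \<and> norm S \<le> C" ..
qed

text \<open>Each round finds a functional that is nonzero on every remaining kernel over a slightly
  smaller disc and cuts \<open>D'\<close> down to its null space. This lowers the dimension of the
  kernel of \<open>T\<close> in \<open>D'\<close>, which \<open>n\<close> bounds by way of
  independent sets.\<close>

lemma kernel_stage:
  assumes fun_ex: "\<And>e. e \<in> D \<Longrightarrow> T e = 0 \<Longrightarrow> e \<noteq> 0 \<Longrightarrow> \<exists>\<phi>. functional \<phi> \<and> \<phi> e \<noteq> 0"
    and "\<And>A. complex_vector.independent A \<Longrightarrow> A \<subseteq> {x\<in>D'. T x = 0} \<Longrightarrow> finite A \<and> card A \<le> n"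
    and "inner_inverses_into D' \<rho>" "0 < r" "r < \<rho>"
  shows "\<exists>D'' \<rho>'. r < \<rho>' \<and> inner_inverses_into D'' \<rho>' \<and> (\<forall>x\<in>D''. T x = 0 \<longrightarrow> x = 0)"
  using assms(2-)
proof (induction n arbitrary: D' \<rho>)
  case 0
  have "x = 0" if "x \<in> D'" "T x = 0" for x
  proof (rule ccontr)
    assume "x \<noteq> 0"
    then have "complex_vector.independent {x}" by simp
    then show False using 0(1)[of "{x}"] that by auto
  qed
  then show ?case using 0 by blast
next
  case (Suc n)
  note D' = Suc.prems(2)
  have sub: "csubspace D'" "D' \<subseteq> D" using D' by (auto simp: inner_inverses_into_def)
  show ?case
  proof (cases "\<forall>x\<in>D'. T x = 0 \<longrightarrow> x = 0")
    case True
    then show ?thesis using Suc.prems by blast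
  next
    case False
    then obtain e where e: "e \<in> D'" "T e = 0" "e \<noteq> 0" by blast
    then obtain \<phi> where \<phi>: "functional \<phi>" "\<phi> e \<noteq> 0" using fun_ex sub by blast
    \<comment> \<open>The midpoint leaves room above \<open>r\<close> for the remaining
      rounds.\<close>
    define \<rho>' where "\<rho>' = (r + \<rho>) / 2"
    have \<rho>': "r < \<rho>'" "\<rho>' < \<rho>" "0 < \<rho>'" using Suc.prems by (auto simp: \<rho>'_def)
    have "\<exists>\<psi>. functional \<psi> \<and> (\<forall>l\<in>cball 0 \<rho>'. \<exists>y\<in>D'. shift T l y = 0 \<and> \<psi> y \<noteq> 0)"
    proof (rule good_on_compact[where U = "ball 0 \<rho>" and a = 0 and v = \<phi> and P = functional])
      show "\<forall>\<^sub>F m in nhds l. \<exists>y\<in>D'. shift T m y = 0 \<and> \<psi> y \<noteq> 0"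
        if \<psi>: "functional \<psi>" and l: "l \<in> ball 0 \<rho>" and y: "\<exists>y\<in>D'. shift T l y = 0 \<and> \<psi> y \<noteq> 0" for \<psi> l
      proof -
        obtain C where "\<forall>\<^sub>F m in nhds l. \<exists>y\<in>D'. shift T m y = 0 \<and> \<psi> y = 1 \<and> norm y \<le> C"
          using local_kernel_section[OF D' l \<psi>] y by (elim bexE conjE) blast
        then show ?thesis by eventually_elim auto
      qed
    qed (use e \<phi> \<rho>' functional_removal[OF D'] in \<open>auto simp: subset_iff\<close>)
    then obtain \<psi> where \<psi>: "functional \<psi>" "\<And>l. l \<in> cball 0 \<rho>' \<Longrightarrow> \<exists>y\<in>D'. shift T l y = 0 \<and> \<psi> y \<noteq> 0"
      by blast
    define D'' where "D'' = {x\<in>D'. \<psi> x = 0}"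
    have D'': "inner_inverses_into D'' \<rho>'" unfolding D''_def
      by (rule inner_inverses_into_Int_kernel[OF D' \<psi>(1)]) (use \<rho>' \<psi> in auto)
    obtain y where y: "y \<in> D'" "T y = 0" "\<psi> y \<noteq> 0" using \<psi>(2)[of 0] \<rho>' by auto
    \<comment> \<open>\<open>\<psi>\<close> vanishes on \<open>D''\<close> but not at
      \<open>y\<close>, so \<open>y\<close> extends every independent subset of the kernel in
      \<open>D''\<close> to a larger one in \<open>D'\<close>.\<close>
    have "finite A \<and> card A \<le> n" if A: "complex_vector.independent A" "A \<subseteq> {x\<in>D''. T x = 0}" for A
    proof -
      have "csubspace D''" using D'' by (simp add: inner_inverses_into_def)
      then have "cspan A \<subseteq> D''" using A by (intro complex_vector.span_minimal) auto
      then have y': "y \<notin> cspan A" using y by (auto simp: D''_def)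
      then have "complex_vector.independent (insert y A)" "y \<notin> A"
        using A complex_vector.span_base by (auto simp: complex_vector.independent_insert)
      moreover have "insert y A \<subseteq> {x\<in>D'. T x = 0}" using A y by (auto simp: D''_def)
      ultimately show ?thesis using Suc.prems(1)[of "insert y A"] by auto
    qed
    then show ?thesis using Suc.IH[OF _ D''] \<rho>' Suc.prems by blast
  qed
qed

end

section \<open>Complements of the ranges\<close>

context closed_operator begin

text \<open>Triviality and its failure are both open in the disc. In the trivial case a kernel
  vector at \<open>m\<close> satisfies \<open>x = (m - l) S x\<close>, which forces
  \<open>x = 0\<close> for \<open>m\<close> near \<open>l\<close>; a nonzero kernel vector
  \<open>y\<close> at \<open>l\<close> yields the nonzero kernel vector
  \<open>y - S (T - m) y\<close> at \<open>m\<close>.\<close>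

lemma trivial_kernel_everywhere:
  assumes D': "inner_inverses_into D' \<rho>" and triv: "\<forall>x\<in>D'. T x = 0 \<longrightarrow> x = 0"
    and l: "l \<in> ball 0 \<rho>"
  shows "\<forall>x\<in>D'. shift T l x = 0 \<longrightarrow> x = 0"
proof (rule connected_eventually_induct[of "ball 0 \<rho>" 0 _ l])
  have sub: "csubspace D'" "D' \<subseteq> D" using D' by (auto simp: inner_inverses_into_def)
  fix l :: complex assume l: "l \<in> ball 0 \<rho>"
  obtain C where C: "\<forall>\<^sub>F m in nhds l. \<exists>S. inner_inverse m S \<and>
        range (blinfun_apply S) \<subseteq> D' \<and> norm S \<le> C"
    using D' l unfolding inner_inverses_into_def by blast
  {
    assume triv: "\<forall>x\<in>D'. shift T l x = 0 \<longrightarrow> x = 0"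
    obtain S where S: "inner_inverse l S" "range (blinfun_apply S) \<subseteq> D'"
      using eventually_nhds_x_imp_x[OF C] by blast
    have "\<forall>\<^sub>F m in nhds l. cmod (m - l) * norm S < 1" by (rule eventually_dist_small) simp
    then show "\<forall>\<^sub>F m in nhds l. m \<in> ball 0 \<rho> \<longrightarrow> (\<forall>x\<in>D'. shift T m x = 0 \<longrightarrow> x = 0)"
    proof (eventually_elim, intro impI ballI)
      fix m x assume m: "cmod (m - l) * norm S < 1" and x: "x \<in> D'" "shift T m x = 0"
      have "x - S (shift T l x) \<in> D'" using S x by (intro complex_vector.subspace_diff sub) auto
      then have "x - S (shift T l x) = 0"
        using triv inner_inverse_diff_kernel[OF S(1), of x] x sub by blast
      moreover have "shift T l x = (m - l) *\<^sub>C x" using shift_eq[of T l x m] x by simp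
      ultimately have "norm x = norm (S ((m - l) *\<^sub>C x))" by simp
      also have "\<dots> \<le> norm S * norm ((m - l) *\<^sub>C x)" by (rule norm_blinfun)
      also have "\<dots> = cmod (m - l) * norm S * norm x" by (simp add: norm_scaleC)
      finally have "norm x * (1 - cmod (m - l) * norm S) \<le> 0" by (simp add: right_diff_distrib mult_ac)
      with m show "x = 0" by (simp add: mult_le_0_iff)
    qed
  next
    assume "\<not> (\<forall>x\<in>D'. shift T l x = 0 \<longrightarrow> x = 0)"
    then obtain y where y: "y \<in> D'" "shift T l y = 0" "y \<noteq> 0" by blast
    have "\<forall>\<^sub>F m in nhds l. cmod (m - l) * (C * norm y) < norm y"
      by (rule eventually_dist_small) (use y in simp)
    with C show "\<forall>\<^sub>F m in nhds l. m \<in> ball 0 \<rho> \<longrightarrow> \<not> (\<forall>x\<in>D'. shift T m x = 0 \<longrightarrow> x = 0)"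
    proof eventually_elim
      case (elim m)
      then obtain S where S: "inner_inverse m S" "range (blinfun_apply S) \<subseteq> D'" "norm S \<le> C"
        by auto
      have Am: "shift T m y = (l - m) *\<^sub>C y" using shift_eq[of T m y l] y by simp
      have "norm (S ((l - m) *\<^sub>C y)) \<le> norm S * norm ((l - m) *\<^sub>C y)" by (rule norm_blinfun)
      also have "\<dots> \<le> C * norm ((l - m) *\<^sub>C y)" by (intro mult_right_mono S) auto
      also have "\<dots> = cmod (m - l) * (C * norm y)"
        by (simp add: norm_scaleC norm_minus_commute)
      also have "\<dots> < norm y" by (rule elim)
      finally have "y - S (shift T m y) \<noteq> 0" using Am by auto
      moreover have "y - S (shift T m y) \<in> D'" using S y by (intro complex_vector.subspace_diff sub) auto
      ultimately show ?case using inner_inverse_diff_kernel[OF S(1), of y] y sub by blast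
    qed
  }
qed (use l triv in \<open>auto intro: le_less_trans[OF norm_ge_zero]\<close>)

definition range_plus :: "'a set \<Rightarrow> 'a set \<Rightarrow> complex \<Rightarrow> 'a set" where
  "range_plus D' N l = {shift T l x + n | x n. x \<in> D' \<and> n \<in> N}"

text \<open>The estimate makes the sum direct: \<open>shift T l x + n = 0\<close> forces
  \<open>x = 0\<close> and then \<open>n = 0\<close>. Once the sum is the whole space,
  \<open>z = (T - l) x + n\<close> is uniquely solvable with \<open>x\<close> depending boundedly on
  \<open>z\<close>.\<close>

definition transversal :: "'a set \<Rightarrow> 'a set \<Rightarrow> real \<Rightarrow> bool" where
  "transversal D' N \<rho> \<longleftrightarrow> csubspace D' \<and> D' \<subseteq> D \<and> csubspace N \<and>
     (\<forall>l\<in>ball 0 \<rho>. closed (range_plus D' N l) \<and>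
        (\<exists>C. \<forall>x\<in>D'. \<forall>n\<in>N. norm x \<le> C * norm (shift T l x + n)))"

lemma range_plusI: "x \<in> D' \<Longrightarrow> n \<in> N \<Longrightarrow> shift T l x + n \<in> range_plus D' N l"
  by (auto simp: range_plus_def)

lemma range_plus_subspace:
  assumes "transversal D' N \<rho>"
  shows "csubspace (range_plus D' N l)"
proof (rule complex_vector.subspaceI)
  have sub: "csubspace D'" "D' \<subseteq> D" "csubspace N" using assms by (auto simp: transversal_def)
  show "0 \<in> range_plus D' N l"
    using range_plusI[of 0 D' 0 N l] sub by (simp add: complex_vector.subspace_0)
  fix u c assume "u \<in> range_plus D' N l"
  then obtain x n where u: "u = shift T l x + n" "x \<in> D'" "n \<in> N" by (auto simp: range_plus_def)
  have eq: "c *\<^sub>C u = shift T l (c *\<^sub>C x) + c *\<^sub>C n"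
    using u sub by (auto simp: shift_scale scaleC_add_right)
  show "c *\<^sub>C u \<in> range_plus D' N l"
    unfolding eq using u sub by (intro range_plusI complex_vector.subspace_scale)
next
  have sub: "csubspace D'" "D' \<subseteq> D" "csubspace N" using assms by (auto simp: transversal_def)
  fix u v assume "u \<in> range_plus D' N l" "v \<in> range_plus D' N l"
  then obtain x n y k where u: "u = shift T l x + n" "x \<in> D'" "n \<in> N"
    and v: "v = shift T l y + k" "y \<in> D'" "k \<in> N" by (auto simp: range_plus_def)
  have eq: "u + v = shift T l (x + y) + (n + k)"
    using u v sub shift_add[of x y l] by (auto simp: subset_iff)
  show "u + v \<in> range_plus D' N l"
    unfolding eq using u v sub by (intro range_plusI complex_vector.subspace_add)
qed

lemma transversal_closed: "transversal D' N \<rho> \<Longrightarrow> l \<in> ball 0 \<rho> \<Longrightarrow> closed (range_plus D' N l)"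
  by (simp add: transversal_def)

lemma transversal_bound:
  assumes "transversal D' N \<rho>" "l \<in> ball 0 \<rho>"
  obtains C where "C > 0" "\<And>x n. x \<in> D' \<Longrightarrow> n \<in> N \<Longrightarrow> norm x \<le> C * norm (shift T l x + n)"
proof -
  obtain C where C: "\<And>x n. x \<in> D' \<Longrightarrow> n \<in> N \<Longrightarrow> norm x \<le> C * norm (shift T l x + n)"
    using assms unfolding transversal_def by blast
  have "norm x \<le> max C 1 * norm (shift T l x + n)" if "x \<in> D'" "n \<in> N" for x n
    using C[OF that] mult_right_mono[of C "max C 1" "norm (shift T l x + n)"] by simp
  then show thesis using that[of "max C 1"] by simp
qed

text \<open>With trivial kernel on \<open>D'\<close>, \<open>x - S (T - l) x\<close> must vanish, so
  \<open>S\<close> is a left inverse on \<open>D'\<close> and its norm serves as the constant. The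
  range is closed because \<open>(T - l) S z = z\<close> passes to limits by the closed
  graph.\<close>

lemma transversal_start:
  assumes D': "inner_inverses_into D' \<rho>" and triv: "\<forall>x\<in>D'. T x = 0 \<longrightarrow> x = 0"
  shows "transversal D' {0} \<rho>"
  unfolding transversal_def
proof (intro conjI ballI)
  show sub: "csubspace D'" "D' \<subseteq> D" using D' by (auto simp: inner_inverses_into_def)
  fix l :: complex assume l: "l \<in> ball 0 \<rho>"
  obtain C where C: "\<forall>\<^sub>F m in nhds l. \<exists>S. inner_inverse m S \<and>
        range (blinfun_apply S) \<subseteq> D' \<and> norm S \<le> C"
    using D' l unfolding inner_inverses_into_def by blast
  obtain S where S: "inner_inverse l S" "range (blinfun_apply S) \<subseteq> D'"
    using eventually_nhds_x_imp_x[OF C] by blast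
  have inv: "S (shift T l x) = x" if "x \<in> D'" for x
  proof -
    have "x - S (shift T l x) \<in> D'" using S that by (intro complex_vector.subspace_diff sub) auto
    then have "x - S (shift T l x) = 0"
      using trivial_kernel_everywhere[OF D' triv l] inner_inverse_diff_kernel[OF S(1), of x] that sub by blast
    then show ?thesis by simp
  qed
  show "\<exists>C. \<forall>x\<in>D'. \<forall>n\<in>{0}. norm x \<le> C * norm (shift T l x + n)"
  proof (intro exI[of _ "norm S"] ballI)
    fix x n assume "x \<in> D'" "n \<in> {0::'a}"
    then show "norm x \<le> norm S * norm (shift T l x + n)"
      using norm_blinfun[of S "shift T l x"] inv[of x] by simp
  qed
  show "closed (range_plus D' {0} l)"
    unfolding closed_sequential_limits
  proof (intro allI impI, elim conjE)
    fix z z0 assume z: "\<forall>n. z n \<in> range_plus D' {0} l" and lim: "z \<longlonglongrightarrow> z0"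
    have z': "shift T l (S (z n)) = z n" for n
      using z[rule_format, of n] by (auto simp: range_plus_def inv)
    have "(\<lambda>n. S (z n)) \<longlonglongrightarrow> S z0" using lim by (intro tendsto_intros)
    then have "shift T l (S z0) = z0"
      by (rule shift_closed(2)[rotated]) (use lim z' S sub in auto)
    moreover have "S z0 \<in> D'" using S by auto
    ultimately show "z0 \<in> range_plus D' {0} l" using range_plusI[of "S z0" D' 0 "{0}" l] by simp
  qed
qed simp

text \<open>If \<open>v = (T - m) x + n\<close>, then \<open>v + (m - l) x\<close> lies in the range
  at \<open>l\<close>. The estimate at \<open>l\<close> bounds \<open>norm x\<close> by
  \<open>2 * C * norm v\<close>, so for \<open>m\<close> near \<open>l\<close> this vector falls
  into a ball around \<open>v\<close> that misses that closed range.\<close>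

lemma range_plus_open:
  assumes tr: "transversal D' N \<rho>" and l: "l \<in> ball 0 \<rho>" and v: "v \<notin> range_plus D' N l"
  shows "\<forall>\<^sub>F m in nhds l. v \<notin> range_plus D' N m"
proof -
  obtain C where C: "C > 0" "\<And>x n. x \<in> D' \<Longrightarrow> n \<in> N \<Longrightarrow> norm x \<le> C * norm (shift T l x + n)"
    using transversal_bound[OF tr l] by metis
  obtain e where e: "e > 0" "ball v e \<subseteq> - range_plus D' N l"
    using transversal_closed[OF tr l] v by (meson ComplI open_Compl open_contains_ball)
  have "\<forall>\<^sub>F m in nhds l. cmod (m - l) * C < 1/2"
    "\<forall>\<^sub>F m in nhds l. cmod (m - l) * (2 * C * norm v) < e"
    by (rule eventually_dist_small; use e in simp)+
  then show ?thesis
  proof eventually_elim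
    case (elim m)
    show ?case
    proof
      assume "v \<in> range_plus D' N m"
      then obtain x n where x: "v = shift T m x + n" "x \<in> D'" "n \<in> N" by (auto simp: range_plus_def)
      have eq: "shift T l x + n = v + (m - l) *\<^sub>C x" using shift_eq[of T l x m] x by simp
      have "norm x \<le> C * norm (v + (m - l) *\<^sub>C x)" using C(2)[OF x(2,3)] eq by simp
      also have "\<dots> \<le> C * (norm v + cmod (m - l) * norm x)"
        using C norm_triangle_ineq[of v "(m - l) *\<^sub>C x"] by (intro mult_left_mono) (auto simp: norm_scaleC)
      also have "\<dots> \<le> C * norm v + 1/2 * norm x"
        using mult_right_mono[of "cmod (m - l) * C" "1/2" "norm x"] elim by (simp add: algebra_simps)
      finally have "norm x \<le> 2 * C * norm v" by simp
      then have "cmod (m - l) * norm x < e"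
        using mult_left_mono[of "norm x" "2 * C * norm v" "cmod (m - l)"] elim by simp
      then have "v + (m - l) *\<^sub>C x \<in> ball v e" by (simp add: dist_norm norm_scaleC)
      moreover have "v + (m - l) *\<^sub>C x \<in> range_plus D' N l"
        unfolding eq[symmetric] using x by (intro range_plusI)
      ultimately show False using e by blast
    qed
  qed
qed

text \<open>Modulo the range at \<open>m\<close>, \<open>w 0\<close> equals \<open>(m - l) ^ j w j\<close>, which tends to zero.\<close>

lemma range_plus_infinite_chain:
  assumes tr: "transversal D' N \<rho>" and m: "m \<in> ball 0 \<rho>"
    and C: "\<And>x n. x \<in> D' \<Longrightarrow> n \<in> N \<Longrightarrow> norm x \<le> C * norm (shift T l x + n)" "C > 0"
    and small: "cmod (m - l) * C < 1"
    and w: "\<And>i. w (Suc i) \<in> D'" "\<And>i. \<exists>n\<in>N. w i = shift T l (w (Suc i)) + n"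
  shows "w 0 \<in> range_plus D' N m"
proof (rule closed_sequentially[OF transversal_closed[OF tr m]])
  note sub = range_plus_subspace[OF tr, of m]
  show "w 0 - (m - l) ^ j *\<^sub>C w j \<in> range_plus D' N m" for j
  proof (induction j)
    case 0
    then show ?case using complex_vector.subspace_0[OF sub] by (simp add: scaleC_one)
  next
    case (Suc j)
    obtain n where n: "n \<in> N" "w j = shift T l (w (Suc j)) + n" using w by blast
    \<comment> \<open>Writing \<open>T - l\<close> as \<open>(T - m) + (m - l)\<close> in
      \<open>w j = (T - l) (w (Suc j)) + n\<close> makes the increment a multiple of an element of
      the range at \<open>m\<close>.\<close>
    have "w 0 - (m - l) ^ Suc j *\<^sub>C w (Suc j) =
      (w 0 - (m - l) ^ j *\<^sub>C w j) + (m - l) ^ j *\<^sub>C (shift T m (w (Suc j)) + n)"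
      using n(2) shift_eq[of T l "w (Suc j)" m]
      by (simp add: scaleC_add_right scaleC_scaleC mult.commute)
    also have "\<dots> \<in> range_plus D' N m"
      by (intro complex_vector.subspace_add[OF sub] complex_vector.subspace_scale[OF sub] range_plusI Suc n w)
    finally show ?case .
  qed
  \<comment> \<open>The estimate at \<open>l\<close> allows at most growth like
    \<open>C ^ j\<close>, which \<open>small\<close> outweighs.\<close>
  have wb: "norm (w j) \<le> C ^ j * norm (w 0)" for j
  proof (induction j)
    case (Suc j)
    obtain n where n: "n \<in> N" "w j = shift T l (w (Suc j)) + n" using w by blast
    then have "norm (w (Suc j)) \<le> C * norm (w j)" using C(1)[OF w(1)] by auto
    also have "\<dots> \<le> C * (C ^ j * norm (w 0))" using Suc C by (intro mult_left_mono) auto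
    finally show ?case by simp
  qed simp
  have "(\<lambda>j. (m - l) ^ j *\<^sub>C w j) \<longlonglongrightarrow> 0"
  proof (rule Lim_null_comparison)
    show "\<forall>\<^sub>F j in sequentially. norm ((m - l) ^ j *\<^sub>C w j) \<le> (cmod (m - l) * C) ^ j * norm (w 0)"
    proof (intro always_eventually allI)
      fix j
      show "norm ((m - l) ^ j *\<^sub>C w j) \<le> (cmod (m - l) * C) ^ j * norm (w 0)"
        using mult_left_mono[OF wb[of j], of "cmod (m - l) ^ j"]
        by (simp add: norm_scaleC norm_power power_mult_distrib mult_ac)
    qed
    have "(\<lambda>j. (cmod (m - l) * C) ^ j * norm (w 0)) \<longlonglongrightarrow> 0 * norm (w 0)"
      using small C by (intro tendsto_mult tendsto_const LIMSEQ_power_zero) auto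
    then show "(\<lambda>j. (cmod (m - l) * C) ^ j * norm (w 0)) \<longlonglongrightarrow> 0" by simp
  qed
  from tendsto_diff[OF tendsto_const this]
  show "(\<lambda>j. w 0 - (m - l) ^ j *\<^sub>C w j) \<longlonglongrightarrow> w 0" by simp
qed

text \<open>Dual to \<open>functional_removal\<close>: if \<open>v = (T - l) x + n\<close>, then
  \<open>v\<close> and \<open>(m - l) x\<close> agree modulo the range at \<open>m\<close>, so
  \<open>x\<close> has the status of \<open>v\<close> for \<open>m \<noteq> l\<close>. Either some
  iterated preimage is outside the range at \<open>l\<close>, or an infinite chain puts
  \<open>v\<close> into the range at all nearby \<open>m\<close>.\<close>

lemma vector_removal:
  assumes tr: "transversal D' N \<rho>" and l: "l \<in> ball 0 \<rho>"
  defines "good \<equiv> \<lambda>v m. v \<notin> range_plus D' N m"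
  shows "(\<forall>\<^sub>F m in nhds l. \<not> good v m) \<or>
    (\<exists>w. good w l \<and> (\<forall>m\<in>ball 0 \<rho> - {l}. good w m \<longleftrightarrow> good v m))"
proof -
  define s where "s z = (SOME x. x \<in> D' \<and> (\<exists>n\<in>N. z = shift T l x + n))" for z
  define w where "w i = (s ^^ i) v" for i
  have s: "s z \<in> D' \<and> (\<exists>n\<in>N. z = shift T l (s z) + n)" if "z \<in> range_plus D' N l" for z
    unfolding s_def by (rule someI_ex) (use that in \<open>auto simp: range_plus_def\<close>)
  have w: "w (Suc i) \<in> D'" "\<exists>n\<in>N. w i = shift T l (w (Suc i)) + n" if "w i \<in> range_plus D' N l" for i
    using s[OF that] by (auto simp: w_def)
  obtain C where C: "C > 0" "\<And>x n. x \<in> D' \<Longrightarrow> n \<in> N \<Longrightarrow> norm x \<le> C * norm (shift T l x + n)"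
    using transversal_bound[OF tr l] by metis
  show ?thesis
  proof (cases "\<exists>i. good (w i) l")
    case True
    define j where "j = (LEAST j. good (w j) l)"
    have j: "good (w j) l" unfolding j_def using True by (rule LeastI_ex)
    have j': "w i \<in> range_plus D' N l" if "i < j" for i
      using that not_less_Least unfolding j_def good_def by blast
    have "good (w j) m \<longleftrightarrow> good v m" if m: "m \<noteq> l" for m
      using j'
    proof (induction j)
      case (Suc j)
      note sub = range_plus_subspace[OF tr, of m]
      obtain n where n: "n \<in> N" "w j = shift T l (w (Suc j)) + n" "w (Suc j) \<in> D'"
        using w[of j] Suc.prems by blast
      have R: "shift T m (w (Suc j)) + n \<in> range_plus D' N m" using n by (intro range_plusI)
      have eq: "w j = (shift T m (w (Suc j)) + n) + (m - l) *\<^sub>C w (Suc j)"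
        using n(2) shift_eq[of T l "w (Suc j)" m] by simp
      have "w j \<in> range_plus D' N m \<longleftrightarrow> (m - l) *\<^sub>C w (Suc j) \<in> range_plus D' N m"
        using complex_vector.subspace_add[OF sub R] complex_vector.subspace_diff[OF sub _ R] eq
        by (metis add_diff_cancel_left')
      also have "\<dots> \<longleftrightarrow> w (Suc j) \<in> range_plus D' N m"
        using m complex_vector.subspace_scale[OF sub, of "(m - l) *\<^sub>C w (Suc j)" "inverse (m - l)"]
          complex_vector.subspace_scale[OF sub, of "w (Suc j)" "m - l"]
        by (auto simp: scaleC_scaleC scaleC_one)
      finally show ?case using Suc by (simp add: good_def)
    qed (simp add: w_def)
    then show ?thesis using j by blast
  next
    case False
    have "\<forall>\<^sub>F m in nhds l. cmod (m - l) * C < 1" by (rule eventually_dist_small) simp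
    moreover have "\<forall>\<^sub>F m in nhds l. m \<in> ball 0 \<rho>" using l by (intro eventually_nhds_in_open) auto
    ultimately have "\<forall>\<^sub>F m in nhds l. \<not> good v m"
    proof eventually_elim
      case (elim m)
      have "w 0 \<in> range_plus D' N m"
        by (rule range_plus_infinite_chain[OF tr elim(2) C(2,1) elim(1)])
          (use False w in \<open>auto simp: good_def\<close>)
      then show ?case by (simp add: good_def w_def)
    qed
    then show ?thesis by simp
  qed
qed

text \<open>The distance \<open>d\<close> of \<open>w\<close> from the closed range at
  \<open>l\<close> bounds the coefficient of \<open>w\<close>, so the estimate survives with the
  constant \<open>C * (1 + norm w / d)\<close>; adding a line preserves closedness.\<close>

lemma transversal_extend:
  assumes tr: "transversal D' N \<rho>" and "\<rho>' \<le> \<rho>"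
    and w: "\<And>l. l \<in> ball 0 \<rho>' \<Longrightarrow> w \<notin> range_plus D' N l"
  defines "N' \<equiv> {n + c *\<^sub>C w | n c. n \<in> N}"
  shows "transversal D' N' \<rho>'" and "range_plus D' N' l = {f + c *\<^sub>C w | f c. f \<in> range_plus D' N l}"
proof -
  have sub: "csubspace D'" "D' \<subseteq> D" "csubspace N" using tr by (auto simp: transversal_def)
  show R: "range_plus D' N' l = {f + c *\<^sub>C w | f c. f \<in> range_plus D' N l}" for l
    unfolding range_plus_def N'_def by (auto simp: add.assoc) (metis add.assoc)+
  have "N' = cspan (insert w N)"
    unfolding N'_def
  proof safe
    show "n + c *\<^sub>C w \<in> cspan (insert w N)" if "n \<in> N" for n c
      using that by (intro complex_vector.span_add complex_vector.span_scale complex_vector.span_base) auto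
    fix x assume "x \<in> cspan (insert w N)"
    then obtain k where "x - k *\<^sub>C w \<in> N"
      using complex_vector.span_eq_iff[THEN iffD2, OF sub(3)] by (auto simp: complex_vector.span_insert)
    then show "\<exists>n c. x = n + c *\<^sub>C w \<and> n \<in> N" by (intro exI[of _ "x - k *\<^sub>C w"] exI[of _ k]) simp
  qed
  then have N': "csubspace N'" by simp
  show "transversal D' N' \<rho>'"
    unfolding transversal_def
  proof (intro conjI ballI sub N')
    fix l :: complex assume l': "l \<in> ball 0 \<rho>'"
    then have l: "l \<in> ball 0 \<rho>" using assms(2) by auto
    note cl = transversal_closed[OF tr l] and Rs = range_plus_subspace[OF tr, of l]
    show "closed (range_plus D' N' l)" unfolding R by (rule closed_csubspace_plus_line[OF cl Rs])
    obtain d where d: "d > 0" "\<And>f c. f \<in> range_plus D' N l \<Longrightarrow> cmod c * d \<le> norm (f + c *\<^sub>C w)"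
      using closed_csubspace_dist[OF cl Rs w[OF l']] by metis
    obtain C where C: "C > 0" "\<And>x n. x \<in> D' \<Longrightarrow> n \<in> N \<Longrightarrow> norm x \<le> C * norm (shift T l x + n)"
      using transversal_bound[OF tr l] by metis
    show "\<exists>C. \<forall>x\<in>D'. \<forall>n\<in>N'. norm x \<le> C * norm (shift T l x + n)"
    proof (intro exI ballI)
      fix x n' assume x: "x \<in> D'" and "n' \<in> N'"
      then obtain n c where n: "n \<in> N" "n' = n + c *\<^sub>C w" by (auto simp: N'_def)
      define q where "q = shift T l x + n'"
      have q: "q = (shift T l x + n) + c *\<^sub>C w" by (simp add: q_def n)
      have "cmod c * d \<le> norm q" unfolding q by (intro d range_plusI x n)
      then have c: "cmod c \<le> norm q / d" using d by (simp add: field_simps)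
      have "norm (shift T l x + n) = norm (q - c *\<^sub>C w)" by (simp add: q)
      also have "\<dots> \<le> norm q + cmod c * norm w" using norm_triangle_ineq4[of q "c *\<^sub>C w"] by (simp add: norm_scaleC)
      also have "\<dots> \<le> norm q + norm q / d * norm w" by (intro add_left_mono mult_right_mono c) simp
      finally have "norm (shift T l x + n) \<le> norm q + norm q / d * norm w" .
      then have "norm x \<le> C * (norm q + norm q / d * norm w)"
        using C(2)[OF x n(1)] C(1) mult_left_mono[of _ _ C] by (meson less_imp_le order_trans)
      then show "norm x \<le> (C * (1 + norm w / d)) * norm (shift T l x + n')"
        by (fold q_def) (simp add: algebra_simps)
    qed
  qed
qed

lemma range_stage:
  assumes "finite B" "card B \<le> k" "\<And>x. \<exists>b\<in>cspan B. x - b \<in> range_plus D' N 0"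
    and "transversal D' N \<rho>" "0 < r" "r < \<rho>"
  shows "\<exists>N' \<rho>'. r < \<rho>' \<and> transversal D' N' \<rho>' \<and> range_plus D' N' 0 = UNIV"
  using assms
proof (induction k arbitrary: B N \<rho>)
  case 0
  \<comment> \<open>\<open>B\<close> is empty here and spans only zero.\<close>
  then have "range_plus D' N 0 = UNIV" by auto
  then show ?case using 0 by blast
next
  case (Suc k)
  note tr = Suc.prems(4)
  show ?case
  proof (cases "range_plus D' N 0 = UNIV")
    case True
    then show ?thesis using Suc.prems by blast
  next
    case False
    then obtain v where v: "v \<notin> range_plus D' N 0" by blast
    define \<rho>' where "\<rho>' = (r + \<rho>) / 2"
    have \<rho>': "r < \<rho>'" "\<rho>' < \<rho>" "0 < \<rho>'" using Suc.prems by (auto simp: \<rho>'_def)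
    have "\<exists>w. True \<and> (\<forall>l\<in>cball 0 \<rho>'. w \<notin> range_plus D' N l)"
      by (rule good_on_compact[where U = "ball 0 \<rho>" and a = 0 and v = v and P = "\<lambda>_. True"])
        (use v \<rho>' vector_removal[OF tr] range_plus_open[OF tr] in \<open>auto simp: subset_iff\<close>)
    then obtain w where w: "\<And>l. l \<in> cball 0 \<rho>' \<Longrightarrow> w \<notin> range_plus D' N l" by blast
    define N' where "N' = {n + c *\<^sub>C w | n c. n \<in> N}"
    have N': "transversal D' N' \<rho>'" "range_plus D' N' 0 = {f + c *\<^sub>C w | f c. f \<in> range_plus D' N 0}"
      unfolding N'_def using transversal_extend[OF tr, of \<rho>' w] \<rho>' w by auto
    note R = range_plus_subspace[OF tr, of 0] and R' = range_plus_subspace[OF N'(1), of 0]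
    have RR: "range_plus D' N 0 \<subseteq> range_plus D' N' 0"
    proof
      fix f assume "f \<in> range_plus D' N 0"
      then show "f \<in> range_plus D' N' 0" unfolding N'(2) by (intro CollectI exI[of _ f] exI[of _ 0]) simp
    qed
    have wR': "w \<in> range_plus D' N' 0"
      unfolding N'(2) using complex_vector.subspace_0[OF R]
      by (intro CollectI exI[of _ 0] exI[of _ 1]) (simp add: scaleC_one)
    obtain s where s: "s \<in> cspan B" "w - s \<in> range_plus D' N 0" using Suc.prems by blast
    obtain c where c: "s = (\<Sum>b\<in>B. c b *\<^sub>C b)"
      using s(1) complex_vector.span_finite[OF Suc.prems(1)] by auto
    \<comment> \<open>If all coefficients vanished, \<open>s\<close> would be zero and
      \<open>w\<close> would lie in the range at \<open>0\<close>.\<close>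
    obtain b where b: "b \<in> B" "c b \<noteq> 0"
    proof (rule ccontr)
      assume "\<not> thesis"
      then have "\<forall>b\<in>B. c b *\<^sub>C b = 0" using that by auto
      then have "s = 0" unfolding c by (rule sum.neutral)
      then show False using s w[of 0] \<rho>' by auto
    qed
    define t where "t = (\<Sum>b\<in>B-{b}. c b *\<^sub>C b)"
    have t: "t \<in> cspan (B - {b})"
      unfolding t_def by (intro complex_vector.span_sum complex_vector.span_scale complex_vector.span_base)
    have st: "s = c b *\<^sub>C b + t"
      unfolding t_def c using b Suc.prems by (subst sum.remove[of B b]) auto
    have "b + inverse (c b) *\<^sub>C t = inverse (c b) *\<^sub>C s"
      using b by (simp add: st scaleC_add_right scaleC_scaleC scaleC_one)
    moreover have "s \<in> range_plus D' N' 0"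
      using complex_vector.subspace_diff[OF R' wR', of "w - s"] s RR by auto
    \<comment> \<open>Modulo the new range, \<open>b\<close> equals \<open>- inverse (c b)\<close>
      times \<open>t\<close>, a combination of the other elements.\<close>
    ultimately have bt: "b + inverse (c b) *\<^sub>C t \<in> range_plus D' N' 0"
      using complex_vector.subspace_scale[OF R'] by metis
    have "\<exists>b'\<in>cspan (B - {b}). x - b' \<in> range_plus D' N' 0" for x
    proof -
      obtain u where u: "u \<in> cspan B" "x - u \<in> range_plus D' N 0" using Suc.prems by blast
      then obtain h where h: "u - h *\<^sub>C b \<in> cspan (B - {b})"
        using complex_vector.span_breakdown[OF b(1) u(1)] by blast
      define b' where "b' = (u - h *\<^sub>C b) - (h * inverse (c b)) *\<^sub>C t"
      have "x - b' = (x - u) + h *\<^sub>C (b + inverse (c b) *\<^sub>C t)"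
        by (simp add: b'_def scaleC_add_right scaleC_scaleC)
      also have "\<dots> \<in> range_plus D' N' 0"
        using complex_vector.subspace_add[OF R' _ complex_vector.subspace_scale[OF R' bt]] u RR by blast
      finally show ?thesis
        using h t by (auto simp: b'_def intro!: bexI complex_vector.span_diff complex_vector.span_scale)
    qed
    then have "\<exists>N'' \<rho>''. r < \<rho>'' \<and> transversal D' N'' \<rho>'' \<and> range_plus D' N'' 0 = UNIV"
      using Suc.prems b \<rho>' by (intro Suc.IH[of "B - {b}" N' \<rho>'] N') (auto simp: card_Diff_singleton)
    then show ?thesis .
  qed
qed

text \<open>Where the sum is full, every vector starts an infinite chain of preimages and so stays
  in the range for nearby parameters; a missing vector stays missing by
  \<open>range_plus_open\<close>.\<close>

lemma range_plus_UNIV: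
  assumes tr: "transversal D' N \<rho>" and full: "range_plus D' N 0 = UNIV" and l: "l \<in> ball 0 \<rho>"
  shows "range_plus D' N l = UNIV"
proof (rule connected_eventually_induct[of "ball 0 \<rho>" 0 _ l])
  fix l :: complex assume l: "l \<in> ball 0 \<rho>" and full: "range_plus D' N l = UNIV"
  define s where "s z = (SOME x. x \<in> D' \<and> (\<exists>n\<in>N. z = shift T l x + n))" for z
  have s: "s z \<in> D' \<and> (\<exists>n\<in>N. z = shift T l (s z) + n)" for z
  proof -
    have "z \<in> range_plus D' N l" using full by simp
    then have "\<exists>x. x \<in> D' \<and> (\<exists>n\<in>N. z = shift T l x + n)" unfolding range_plus_def by blast
    then show ?thesis unfolding s_def by (rule someI_ex)
  qed
  obtain C where C: "C > 0" "\<And>x n. x \<in> D' \<Longrightarrow> n \<in> N \<Longrightarrow> norm x \<le> C * norm (shift T l x + n)"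
    using transversal_bound[OF tr l] by metis
  have "\<forall>\<^sub>F m in nhds l. cmod (m - l) * C < 1" by (rule eventually_dist_small) simp
  then show "\<forall>\<^sub>F m in nhds l. m \<in> ball 0 \<rho> \<longrightarrow> range_plus D' N m = UNIV"
  proof (eventually_elim, intro impI UNIV_eq_I[symmetric])
    fix m v assume m: "cmod (m - l) * C < 1" "m \<in> ball 0 \<rho>"
    have "(s ^^ 0) v \<in> range_plus D' N m"
      by (rule range_plus_infinite_chain[OF tr m(2) C(2,1) m(1), where w = "\<lambda>i. (s ^^ i) v"])
        (use s in auto)
    then show "v \<in> range_plus D' N m" by simp
  qed
next
  fix l :: complex assume l: "l \<in> ball 0 \<rho>" and "range_plus D' N l \<noteq> UNIV"
  then obtain v where "v \<notin> range_plus D' N l" by blast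
  from range_plus_open[OF tr l this]
  show "\<forall>\<^sub>F m in nhds l. m \<in> ball 0 \<rho> \<longrightarrow> range_plus D' N m \<noteq> UNIV" by eventually_elim auto
qed (use l full in \<open>auto intro: le_less_trans[OF norm_ge_zero]\<close>)

text \<open>\<open>S\<close> sends \<open>T x + n\<close> to \<open>x\<close>. The corresponding
  solution operator \<open>sol l\<close> for \<open>T - l\<close> gives the inverse
  \<open>I + l sol l\<close> of \<open>I - l S\<close>.\<close>

lemma inner_inverse_with_resolvent:
  assumes tr: "transversal D' N \<rho>" and full: "range_plus D' N 0 = UNIV"
    and range: "T ` D \<subseteq> T ` D'" and "0 < \<rho>"
  shows "\<exists>S. inner_inverse 0 S \<and> (\<forall>l\<in>ball 0 \<rho>. \<exists>V\<in>bounded_operators.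
      \<forall>x. V (x - l *\<^sub>C S x) = x \<and> V x - l *\<^sub>C S (V x) = x)"
proof -
  have sub: "csubspace D'" "D' \<subseteq> D" "csubspace N" using tr by (auto simp: transversal_def)
  define sol where "sol l z = (SOME x. x \<in> D' \<and> (\<exists>n\<in>N. z = shift T l x + n))" for l z
  have sol: "sol l z \<in> D'" "\<exists>n\<in>N. z = shift T l (sol l z) + n" if "l \<in> ball 0 \<rho>" for l z
  proof -
    have "z \<in> range_plus D' N l" using range_plus_UNIV[OF tr full that] by simp
    then have "\<exists>x. x \<in> D' \<and> (\<exists>n\<in>N. z = shift T l x + n)" unfolding range_plus_def by blast
    then have "sol l z \<in> D' \<and> (\<exists>n\<in>N. z = shift T l (sol l z) + n)"
      unfolding sol_def by (rule someI_ex)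
    then show "sol l z \<in> D'" "\<exists>n\<in>N. z = shift T l (sol l z) + n" by auto
  qed
  have uniq: "sol l (shift T l x + n) = x" if l: "l \<in> ball 0 \<rho>" and x: "x \<in> D'" "n \<in> N" for l x n
  proof -
    define y where "y = sol l (shift T l x + n)"
    obtain k where y: "y \<in> D'" "k \<in> N" "shift T l x + n = shift T l y + k"
      using sol[OF l] unfolding y_def by metis
    obtain C where C: "C > 0" "\<And>x n. x \<in> D' \<Longrightarrow> n \<in> N \<Longrightarrow> norm x \<le> C * norm (shift T l x + n)"
      using transversal_bound[OF tr l] by metis
    \<comment> \<open>The estimate is applied to the difference of two solutions of one
      equation.\<close>
    have "norm (y - x) \<le> C * norm (shift T l (y - x) + (k - n))"
      using x y by (intro C complex_vector.subspace_diff sub)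
    also have "shift T l (y - x) = shift T l y - shift T l x"
      using x y sub by (intro shift_diff) auto
    also have "\<dots> + (k - n) = (shift T l y + k) - (shift T l x + n)"
      by (rule add_diff_add[symmetric])
    also have "\<dots> = 0" using y(3) by simp
    finally show ?thesis by (simp add: y_def)
  qed
  have sol_add: "sol l (u + v) = sol l u + sol l v" if l: "l \<in> ball 0 \<rho>" for l u v
  proof -
    obtain n k where n: "n \<in> N" "u = shift T l (sol l u) + n" and k: "k \<in> N" "v = shift T l (sol l v) + k"
      using sol(2)[OF l] by metis
    have "u + v = shift T l (sol l u + sol l v) + (n + k)"
      using arg_cong2[OF n(2) k(2), of "(+)"] shift_add[of "sol l u" "sol l v" l] sol(1)[OF l] sub
      by (simp add: subset_iff add_ac)
    then show ?thesis
      using uniq[OF l, of "sol l u + sol l v" "n + k"] n k sol(1)[OF l] sub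
      by (simp add: complex_vector.subspace_add)
  qed
  have sol_scale: "sol l (c *\<^sub>C u) = c *\<^sub>C sol l u" if l: "l \<in> ball 0 \<rho>" for l u c
  proof -
    obtain n where n: "n \<in> N" "u = shift T l (sol l u) + n"
      using sol(2)[OF l] by metis
    have "c *\<^sub>C u = shift T l (c *\<^sub>C sol l u) + c *\<^sub>C n"
      using arg_cong[OF n(2), of "\<lambda>x. c *\<^sub>C x"] sol(1)[OF l] sub
      by (subst shift_scale) (auto simp: scaleC_add_right)
    then show ?thesis
      using uniq[OF l, of "c *\<^sub>C sol l u" "c *\<^sub>C n"] n sol(1)[OF l] sub
      by (simp add: complex_vector.subspace_scale)
  qed
  have bl: "bounded_linear (sol l)" if l: "l \<in> ball 0 \<rho>" for l
  proof -
    obtain C where C: "C > 0" "\<And>x n. x \<in> D' \<Longrightarrow> n \<in> N \<Longrightarrow> norm x \<le> C * norm (shift T l x + n)"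
      using transversal_bound[OF tr l] by metis
    have "norm (sol l z) \<le> norm z * C" for z
      using sol[OF l, of z] C(2)[of "sol l z"] by (metis mult.commute)
    then show ?thesis
      by (intro bounded_linear_intro[where K = C]) (auto simp: sol_add[OF l] sol_scale[OF l] scaleR_scaleC)
  qed
  define S where "S l = Blinfun (sol l)" for l
  have S: "blinfun_apply (S l) = sol l" if "l \<in> ball 0 \<rho>" for l
    unfolding S_def by (rule bounded_linear_Blinfun_apply[OF bl[OF that]])
  have S_bo: "S l \<in> bounded_operators" if "l \<in> ball 0 \<rho>" for l
    using that by (auto simp: bounded_operators_def S sol_scale)
  have 0: "0 \<in> ball 0 \<rho>" using assms by simp
  have "inner_inverse 0 (S 0)"
    unfolding inner_inverse_def
  proof (intro conjI ballI S_bo 0)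
    show "range (blinfun_apply (S 0)) \<subseteq> D" using sol(1)[OF 0] sub by (auto simp: S[OF 0])
    fix x assume "x \<in> D"
    then obtain y where y: "y \<in> D'" "T x = T y" using range by blast
    have "sol 0 (T x) = y"
      using uniq[OF 0 y(1), of 0] y complex_vector.subspace_0[OF sub(3)] by simp
    then show "shift T 0 (S 0 (shift T 0 x)) = shift T 0 x" using y by (simp add: S[OF 0])
  qed
  moreover have "\<exists>V\<in>bounded_operators. \<forall>x. V (x - l *\<^sub>C S 0 x) = x \<and> V x - l *\<^sub>C S 0 (V x) = x"
    if l: "l \<in> ball 0 \<rho>" for l
  proof (intro bexI allI conjI)
    \<comment> \<open>If \<open>z = T x + n\<close> with \<open>x = S z\<close>, then
      \<open>z - l x = (T - l) x + n\<close>, so \<open>sol l\<close> maps \<open>z - l S z\<close>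
      to \<open>S z\<close>; exchanging \<open>0\<close> and \<open>l\<close> gives the other
      identity.\<close>
    let ?V = "id_blinfun + l *\<^sub>C S l"
    have V: "?V z = z + l *\<^sub>C sol l z" for z
      by (simp add: blinfun.add_left scaleC_blinfun.rep_eq S[OF l])
    show "?V \<in> bounded_operators"
      unfolding bounded_operators_def
      by (simp add: V sol_scale[OF l] scaleC_add_right scaleC_scaleC mult.commute)
    fix z
    obtain n where n: "n \<in> N" "z = shift T 0 (sol 0 z) + n" using sol(2)[OF 0] by metis
    have "z - l *\<^sub>C sol 0 z = (shift T 0 (sol 0 z) + n) - l *\<^sub>C sol 0 z"
      by (simp only: n(2)[symmetric])
    also have "\<dots> = shift T l (sol 0 z) + n"
      using shift_eq[of T 0 "sol 0 z" l] by simp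
    finally have "sol l (z - l *\<^sub>C sol 0 z) = sol 0 z"
      using uniq[OF l sol(1)[OF 0] n(1)] by simp
    then show "?V (z - l *\<^sub>C S 0 z) = z" by (simp add: V S[OF 0])
    obtain n where n: "n \<in> N" "z = shift T l (sol l z) + n" using sol(2)[OF l] by metis
    have "z + l *\<^sub>C sol l z = (shift T l (sol l z) + n) + l *\<^sub>C sol l z"
      by (simp only: n(2)[symmetric])
    also have "\<dots> = shift T 0 (sol l z) + n"
      using shift_eq[of T 0 "sol l z" l] by simp
    finally have "sol 0 (z + l *\<^sub>C sol l z) = sol l z"
      using uniq[OF 0 sol(1)[OF l] n(1)] by simp
    then show "?V z - l *\<^sub>C S 0 (?V z) = z" by (simp add: V S[OF 0])
  qed
  ultimately show ?thesis by blast
qed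

end

section \<open>Resolvents of inner inverses and regularity\<close>

context closed_operator begin

text \<open>The range of the \<open>n\<close>-th power of \<open>T\<close> on its natural
  domain.\<close>

definition iter_range :: "nat \<Rightarrow> 'a set" where
  "iter_range n = ((\<lambda>M. T ` (D \<inter> M)) ^^ n) UNIV"

lemma iter_range_simps: "iter_range 0 = UNIV" "iter_range (Suc n) = T ` (D \<inter> iter_range n)"
  by (auto simp: iter_range_def)

lemma T_add: "x \<in> D \<Longrightarrow> y \<in> D \<Longrightarrow> T (x + y) = T x + T y"
  and T_scale: "x \<in> D \<Longrightarrow> T (c *\<^sub>C x) = c *\<^sub>C T x"
  and T_diff: "x \<in> D \<Longrightarrow> y \<in> D \<Longrightarrow> T (x - y) = T x - T y"
  and T_zero [simp]: "T 0 = 0"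
  using shift_add[of _ _ 0] shift_scale[of _ 0] shift_diff[of _ _ 0] shift_zero[of 0] by simp_all

lemma iter_range_subspace: "csubspace (iter_range n)"
proof (induction n)
  case (Suc n)
  note sub = complex_vector.subspace_0 complex_vector.subspace_add complex_vector.subspace_scale
  show ?case
    unfolding iter_range_simps
  proof (rule complex_vector.subspaceI)
    show "0 \<in> T ` (D \<inter> iter_range n)"
      using sub(1)[OF D_subspace] sub(1)[OF Suc] by (intro image_eqI[of _ _ 0]) auto
    fix u v c assume "u \<in> T ` (D \<inter> iter_range n)"
    then obtain x where x: "u = T x" "x \<in> D" "x \<in> iter_range n" by blast
    show "c *\<^sub>C u \<in> T ` (D \<inter> iter_range n)"
      using x sub(3)[OF D_subspace] sub(3)[OF Suc] by (intro image_eqI[of _ _ "c *\<^sub>C x"]) (auto simp: T_scale)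
    assume "v \<in> T ` (D \<inter> iter_range n)"
    then obtain y where y: "v = T y" "y \<in> D" "y \<in> iter_range n" by blast
    show "u + v \<in> T ` (D \<inter> iter_range n)"
      using x y sub(2)[OF D_subspace] sub(2)[OF Suc] by (intro image_eqI[of _ _ "x + y"]) (auto simp: T_add)
  qed
qed (simp add: iter_range_simps)

lemma generalized_inverse_imp_inner_inverse:
  "generalized_inverse D (shift T m) S \<Longrightarrow> inner_inverse m S"
  by (simp add: generalized_inverse_def inner_inverse_def)

text \<open>
  The vector \<open>y - R m (T - m) y\<close> is an eigenvector for \<open>m \<noteq> 0\<close>, hence lies in every iterated range,
  and it tends to \<open>y\<close> as \<open>m\<close> tends to zero.
\<close>

lemma kernel_subset_closed_iter_range:
  assumes reg: "0 \<in> reg D T" and cl: "closed (iter_range n)" and y: "y \<in> D" "T y = 0"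
  shows "y \<in> iter_range n"
proof -
  obtain V R where V: "open V" "0 \<in> V" "analytic_map R V"
    and gi: "\<And>m. m \<in> V \<Longrightarrow> generalized_inverse D (shift T m) (R m)"
    using reg unfolding reg_def by blast
  obtain d where "(R has_derivative (\<lambda>h. h *\<^sub>C d)) (at 0)"
    using V unfolding analytic_map_def by blast
  then have R: "(R \<longlongrightarrow> R 0) (at 0)"
    using has_derivative_continuous continuous_at by blast
  have in_range: "x \<in> iter_range k" if "x \<in> D" "T x = m *\<^sub>C x" "m \<noteq> 0" for k x m
  proof (induction k)
    case (Suc k)
    have "x = T (inverse m *\<^sub>C x)" using that by (simp add: T_scale scaleC_scaleC scaleC_one)
    moreover have "inverse m *\<^sub>C x \<in> D \<inter> iter_range k"
      using that Suc complex_vector.subspace_scale[OF D_subspace]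
        complex_vector.subspace_scale[OF iter_range_subspace] by blast
    ultimately show ?case unfolding iter_range_simps by blast
  qed (simp add: iter_range_simps)
  have "((\<lambda>m. y - R m (shift T m y)) \<longlongrightarrow> y - R 0 (T y - 0 *\<^sub>C y)) (at 0)"
    unfolding shift_def by (intro tendsto_diff tendsto_const blinfun.tendsto R tendsto_scaleC tendsto_ident_at)
  then have lim: "((\<lambda>m. y - R m (shift T m y)) \<longlongrightarrow> y) (at 0)" using y by simp
  have "\<forall>\<^sub>F m in at 0. m \<in> V" using V by (auto simp: eventually_at_topological)
  moreover have "\<forall>\<^sub>F m in at (0::complex). m \<noteq> 0" by (simp add: eventually_at_filter)
  ultimately have "\<forall>\<^sub>F m in at 0. y - R m (shift T m y) \<in> iter_range n"
  proof eventually_elim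
    case (elim m)
    note ii = generalized_inverse_imp_inner_inverse[OF gi[OF elim(1)]]
    let ?x = "y - R m (shift T m y)"
    have "?x \<in> D"
      using ii y by (intro complex_vector.subspace_diff[OF D_subspace]) (auto simp: inner_inverse_def)
    moreover have "T ?x = m *\<^sub>C ?x"
      using inner_inverse_diff_kernel[OF ii y(1)] by (simp add: shift_def)
    ultimately show ?case using in_range elim(2) by blast
  qed
  then show ?thesis by (rule Lim_in_closed_set[OF cl _ _ lim]) simp
qed

text \<open>If \<open>z = T w\<close> with \<open>w\<close> in the \<open>n\<close>-th range, then
  \<open>S z\<close> differs from \<open>w\<close> by a kernel vector, and the kernel lies in that
  closed range.\<close>

lemma inner_inverse_iter_range:
  assumes reg: "0 \<in> reg D T" and S: "inner_inverse 0 S" and cl: "closed (iter_range n)"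
    and z: "z \<in> iter_range (Suc n)"
  shows "S z \<in> iter_range n" "T (S z) = z"
proof -
  have SD: "S u \<in> D" for u using S by (auto simp: inner_inverse_def)
  obtain w where w: "z = T w" "w \<in> D" "w \<in> iter_range n"
    using z unfolding iter_range_simps by blast
  show TST: "T (S z) = z" using S w by (simp add: inner_inverse_def)
  have "w - S z \<in> iter_range n"
    using w SD TST by (intro kernel_subset_closed_iter_range[OF reg cl])
      (auto simp: T_diff intro: complex_vector.subspace_diff[OF D_subspace])
  from complex_vector.subspace_diff[OF iter_range_subspace w(3) this]
  show "S z \<in> iter_range n" by simp
qed

text \<open>Closedness of one iterated range puts the kernel into it, whence \<open>S\<close>
  carries the next range back into it; continuity of \<open>S\<close> and the closed graph then
  close the next range.\<close>

lemma iter_range_closed: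
  assumes reg: "0 \<in> reg D T" and S: "inner_inverse 0 S"
  shows "closed (iter_range n)"
proof (induction n)
  case (Suc n)
  have SD: "S u \<in> D" for u using S by (auto simp: inner_inverse_def)
  note * = inner_inverse_iter_range[OF reg S Suc]
  show ?case
    unfolding closed_sequential_limits
  proof (intro allI impI, elim conjE)
    fix z z0 assume z: "\<forall>k. z k \<in> iter_range (Suc n)" and lim: "z \<longlonglongrightarrow> z0"
    have limS: "(\<lambda>k. S (z k)) \<longlonglongrightarrow> S z0" using lim by (intro tendsto_intros)
    have "S z0 \<in> iter_range n"
      by (rule closed_sequentially[OF Suc _ limS]) (use * z in blast)
    moreover have "T (S z0) = z0"
      using shift_closed(2)[OF SD limS, of 0 z0] * z lim by simp
    ultimately show "z0 \<in> iter_range (Suc n)"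
      unfolding iter_range_simps using SD by (intro image_eqI[of _ _ "S z0"]) auto
  qed
qed (simp add: iter_range_simps)

text \<open>
  A closed \<open>S\<close>-invariant subspace containing \<open>ker T\<close> on which \<open>T S\<close> is the identity; it replaces the
  intersection of the iterated ranges.
\<close>

definition stable_set :: "('a \<Rightarrow>\<^sub>L 'a) \<Rightarrow> 'a set" where
  "stable_set S = {x. \<forall>n. T (S ((blinfun_apply S ^^ n) x)) = (blinfun_apply S ^^ n) x}"

text \<open>The kernel lies in all iterated ranges and \<open>S\<close> maps each into the preceding
  one, so all iterates of \<open>y\<close> under \<open>S\<close> stay in all of them, where
  \<open>T S\<close> is the identity.\<close>

lemma kernel_subset_stable_set:
  assumes reg: "0 \<in> reg D T" and S: "inner_inverse 0 S" and y: "y \<in> D" "T y = 0"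
  shows "y \<in> stable_set S"
proof -
  note ker = kernel_subset_closed_iter_range[OF reg iter_range_closed[OF reg S]]
  note S_range = inner_inverse_iter_range[OF reg S iter_range_closed[OF reg S]]
  have "(blinfun_apply S ^^ k) y \<in> iter_range n" for k n
    by (induction k arbitrary: n) (use ker[OF y] S_range in auto)
  then show ?thesis using S_range(2) by (simp add: stable_set_def)
qed

lemma stable_set_closed:
  assumes S: "inner_inverse 0 S"
  shows "closed (stable_set S)"
  unfolding closed_sequential_limits
proof (intro allI impI, elim conjE)
  fix z z0 assume z: "\<forall>k. z k \<in> stable_set S" and lim: "z \<longlonglongrightarrow> z0"
  have SD: "S u \<in> D" for u using S by (auto simp: inner_inverse_def)
  have "T (S ((blinfun_apply S ^^ n) z0)) = (blinfun_apply S ^^ n) z0" for n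
  proof -
    have limn: "(\<lambda>k. (blinfun_apply S ^^ n) (z k)) \<longlonglongrightarrow> (blinfun_apply S ^^ n) z0"
      by (induction n) (auto intro!: tendsto_intros lim)
    then have "(\<lambda>k. S ((blinfun_apply S ^^ n) (z k))) \<longlonglongrightarrow> S ((blinfun_apply S ^^ n) z0)"
      by (intro tendsto_intros)
    from shift_closed(2)[OF SD this, of 0 "(blinfun_apply S ^^ n) z0"] limn z
    show ?thesis by (simp add: stable_set_def)
  qed
  then show "z0 \<in> stable_set S" by (simp add: stable_set_def)
qed

lemma stable_set_subspace:
  assumes S: "inner_inverse 0 S"
  shows "csubspace (stable_set S)"
proof -
  have SD: "S u \<in> D" for u using S by (auto simp: inner_inverse_def)
  have add: "(blinfun_apply S ^^ n) (x + y) = (blinfun_apply S ^^ n) x + (blinfun_apply S ^^ n) y" for n x y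
    by (induction n) (auto simp: blinfun.add_right)
  have scale: "(blinfun_apply S ^^ n) (c *\<^sub>C x) = c *\<^sub>C (blinfun_apply S ^^ n) x" for n c x
    using S by (induction n) (auto simp: bounded_operators_scaleC inner_inverse_def)
  have "(blinfun_apply S ^^ n) 0 = 0" for n by (induction n) auto
  then show ?thesis
    using S SD by (intro complex_vector.subspaceI)
      (auto simp: stable_set_def add scale blinfun.add_right T_add T_scale bounded_operators_scaleC inner_inverse_def)
qed

lemma stable_set_invariant: "x \<in> stable_set S \<Longrightarrow> S x \<in> stable_set S"
  by (auto simp: stable_set_def) (metis comp_apply funpow_Suc_right)

end

section \<open>The inverse of I - l S as a function of l\<close>

locale resolvent_family =
  fixes S :: "'a::complex_banach \<Rightarrow>\<^sub>L 'a" and V :: "complex \<Rightarrow> 'a \<Rightarrow>\<^sub>L 'a" and \<rho> :: real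
  assumes S_bo: "S \<in> bounded_operators"
    and V_bo: "\<And>l. l \<in> ball 0 \<rho> \<Longrightarrow> V l \<in> bounded_operators"
    and V_left: "\<And>l x. l \<in> ball 0 \<rho> \<Longrightarrow> V l (x - l *\<^sub>C S x) = x"
    and V_right: "\<And>l x. l \<in> ball 0 \<rho> \<Longrightarrow> V l x - l *\<^sub>C S (V l x) = x"
begin

lemma S_diff_scale: "S (x - l *\<^sub>C y) = S x - l *\<^sub>C S y"
  by (simp add: blinfun.diff_right bounded_operators_scaleC[OF S_bo])

lemma V_commute:
  assumes "l \<in> ball 0 \<rho>"
  shows "V l (S x) = S (V l x)"
proof -
  have "S x = S (V l x) - l *\<^sub>C S (S (V l x))"
    using arg_cong[OF V_right[OF assms, of x], of "blinfun_apply S"] by (simp add: S_diff_scale)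
  then show ?thesis using V_left[OF assms] by metis
qed

text \<open>The resolvent identity: \<open>I - l S\<close> sends \<open>V m x\<close> to
  \<open>x + (m - l) S (V m x)\<close>, and \<open>V l\<close> undoes it.\<close>

lemma V_diff:
  assumes l: "l \<in> ball 0 \<rho>" and m: "m \<in> ball 0 \<rho>"
  shows "V m - V l = (m - l) *\<^sub>C (V l o\<^sub>L S o\<^sub>L V m)"
proof (rule blinfun_eqI)
  fix x
  have "V m x - l *\<^sub>C S (V m x) = x + (m - l) *\<^sub>C S (V m x)"
    using V_right[OF m, of x] by (simp add: complex_vector.scale_left_diff_distrib algebra_simps)
  then have "V m x = V l (x + (m - l) *\<^sub>C S (V m x))" using V_left[OF l] by metis
  also have "\<dots> = V l x + (m - l) *\<^sub>C V l (S (V m x))"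
    by (simp add: blinfun.add_right bounded_operators_scaleC[OF V_bo[OF l]])
  finally show "(V m - V l) x = ((m - l) *\<^sub>C (V l o\<^sub>L S o\<^sub>L V m)) x"
    by (simp add: blinfun.diff_left scaleC_blinfun.rep_eq diff_eq_eq add.commute)
qed

text \<open>The resolvent identity alone bounds \<open>V\<close> near \<open>l\<close>: once
  \<open>cmod (m - l) * ?K\<close> is below \<open>1/2\<close>, \<open>norm (V m)\<close> is at most
  \<open>2 * norm (V l)\<close>.\<close>

lemma V_continuous:
  assumes l: "l \<in> ball 0 \<rho>"
  shows "(V \<longlongrightarrow> V l) (at l)"
proof -
  let ?K = "norm (V l o\<^sub>L S)"
  have in_ball: "\<forall>\<^sub>F m in at l. m \<in> ball 0 \<rho>"
    using l open_ball unfolding eventually_at_topological by blast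
  have small: "\<forall>\<^sub>F m in at l. cmod (m - l) * ?K < 1/2"
    using eventually_dist_small[of "1/2" l ?K] by (auto simp: eventually_at_filter elim: eventually_mono)
  have "((\<lambda>m. V m - V l) \<longlongrightarrow> 0) (at l)"
  proof (rule Lim_null_comparison)
    show "\<forall>\<^sub>F m in at l. norm (V m - V l) \<le> cmod (m - l) * (?K * (2 * norm (V l)))"
      using in_ball small
    proof eventually_elim
      case (elim m)
      have eq: "norm (V m - V l) \<le> cmod (m - l) * (?K * norm (V m))"
        unfolding V_diff[OF l elim(1)] norm_scaleC by (intro mult_left_mono norm_blinfun_compose) auto
      have "norm (V m) \<le> norm (V l) + norm (V m - V l)" by (rule norm_triangle_sub)
      also have "\<dots> \<le> norm (V l) + 1/2 * norm (V m)"
        using eq mult_right_mono[of "cmod (m - l) * ?K" "1/2" "norm (V m)"] elim by (simp add: mult.assoc)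
      finally have "norm (V m) \<le> 2 * norm (V l)" by simp
      then have "cmod (m - l) * (?K * norm (V m)) \<le> cmod (m - l) * (?K * (2 * norm (V l)))"
        by (intro mult_left_mono) auto
      with eq show ?case by simp
    qed
    have "((\<lambda>m. cmod (m - l) * (?K * (2 * norm (V l)))) \<longlongrightarrow> cmod (l - l) * (?K * (2 * norm (V l)))) (at l)"
      by (intro tendsto_intros)
    then show "((\<lambda>m. cmod (m - l) * (?K * (2 * norm (V l)))) \<longlongrightarrow> 0) (at l)" by simp
  qed
  then show ?thesis by (rule LIM_zero_cancel)
qed

text \<open>The difference quotient is \<open>V l S V m\<close>, which converges by continuity of
  \<open>V\<close>.\<close>

lemma V_has_derivative:
  assumes l: "l \<in> ball 0 \<rho>"
  shows "(V has_derivative (\<lambda>h. h *\<^sub>C (V l o\<^sub>L S o\<^sub>L V l))) (at l)"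
  unfolding has_derivative_iff_norm
proof
  show "bounded_linear (\<lambda>h. h *\<^sub>C (V l o\<^sub>L S o\<^sub>L V l))"
    by (rule bounded_bilinear.bounded_linear_left[OF bounded_bilinear_scaleC])
  have "\<forall>\<^sub>F m in at l. m \<in> ball 0 \<rho>" "\<forall>\<^sub>F m in at l. m \<noteq> l"
    using l open_ball unfolding eventually_at_topological by blast+
  then have "\<forall>\<^sub>F m in at l. norm ((V l o\<^sub>L S) o\<^sub>L (V m - V l)) =
      norm (V m - V l - (m - l) *\<^sub>C (V l o\<^sub>L S o\<^sub>L V l)) / norm (m - l)"
  proof eventually_elim
    case (elim m)
    have "V m - V l - (m - l) *\<^sub>C (V l o\<^sub>L S o\<^sub>L V l) =
        (m - l) *\<^sub>C (V l o\<^sub>L S o\<^sub>L V m) - (m - l) *\<^sub>C (V l o\<^sub>L S o\<^sub>L V l)"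
      by (simp only: V_diff[OF l elim(1)])
    also have "\<dots> = (m - l) *\<^sub>C ((V l o\<^sub>L S) o\<^sub>L (V m - V l))"
      by (rule blinfun_eqI) (simp add: blinfun.diff_left blinfun.diff_right
        scaleC_blinfun.rep_eq complex_vector.scale_right_diff_distrib)
    finally have "V m - V l - (m - l) *\<^sub>C (V l o\<^sub>L S o\<^sub>L V l) = (m - l) *\<^sub>C ((V l o\<^sub>L S) o\<^sub>L (V m - V l))" .
    then show ?case using elim by (simp add: norm_scaleC)
  qed
  moreover have "((\<lambda>m. norm ((V l o\<^sub>L S) o\<^sub>L (V m - V l))) \<longlongrightarrow> norm ((V l o\<^sub>L S) o\<^sub>L (V l - V l))) (at l)"
    by (intro tendsto_norm bounded_bilinear.tendsto[OF bounded_bilinear_blinfun_compose] tendsto_intros V_continuous[OF l])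
  ultimately show "((\<lambda>m. norm (V m - V l - (m - l) *\<^sub>C (V l o\<^sub>L S o\<^sub>L V l)) / norm (m - l)) \<longlongrightarrow> 0) (at l)"
    using Lim_transform_eventually by (fastforce simp: blinfun.zero_right)
qed

text \<open>\<open>V 0\<close> is the identity, and invariance spreads along the disc: nearby
  parameters inherit it through a fixed point inside \<open>M\<close>, while its failure at a vector
  persists by continuity.\<close>

lemma V_invariant:
  assumes cl: "closed M" and sub: "csubspace M" and inv: "\<And>x. x \<in> M \<Longrightarrow> S x \<in> M"
    and l: "l \<in> ball 0 \<rho>"
  shows "\<forall>x\<in>M. V l x \<in> M"
proof (rule connected_eventually_induct[of "ball 0 \<rho>" 0 _ l])
  have "0 \<in> ball 0 \<rho>" using l by (auto intro: le_less_trans[OF norm_ge_zero])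
  then show "0 \<in> ball 0 \<rho>" "\<forall>x\<in>M. V 0 x \<in> M" using V_left[of 0] by auto
next
  fix l assume l: "l \<in> ball 0 \<rho>" and VM: "\<forall>x\<in>M. V l x \<in> M"
  let ?K = "norm (S o\<^sub>L V l)"
  have "\<forall>\<^sub>F m in nhds l. cmod (m - l) * ?K < 1" by (rule eventually_dist_small) simp
  then show "\<forall>\<^sub>F m in nhds l. m \<in> ball 0 \<rho> \<longrightarrow> (\<forall>x\<in>M. V m x \<in> M)"
  proof (eventually_elim, intro impI ballI)
    fix m x assume small: "cmod (m - l) * ?K < 1" and m: "m \<in> ball 0 \<rho>" and x: "x \<in> M"
    \<comment> \<open>A fixed point \<open>z\<close> of \<open>g\<close> satisfies
      \<open>(I - m S) (V l z) = x\<close>, so \<open>V m x = V l z\<close>; the contraction acts on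
      the complete set \<open>M\<close>.\<close>
    define g where "g z = x + (m - l) *\<^sub>C S (V l z)" for z
    have "\<exists>!z\<in>M. g z = z"
    proof (rule Banach_fix[where c = "cmod (m - l) * ?K"])
      show "g ` M \<subseteq> M"
        using x VM inv sub unfolding g_def
        by (auto intro!: complex_vector.subspace_add complex_vector.subspace_scale)
      fix u v
      have "g u - g v = (m - l) *\<^sub>C (S o\<^sub>L V l) (u - v)"
        by (simp add: g_def blinfun.diff_right complex_vector.scale_right_diff_distrib)
      then show "dist (g u) (g v) \<le> cmod (m - l) * ?K * dist u v"
        using mult_left_mono[OF norm_blinfun[of "S o\<^sub>L V l" "u - v"], of "cmod (m - l)"]
        by (simp add: dist_norm norm_scaleC mult.assoc)
    qed (use cl x small in \<open>auto simp: complete_eq_closed\<close>)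
    then obtain z where z: "z \<in> M" "x + (m - l) *\<^sub>C S (V l z) = z" by (auto simp: g_def)
    have "V l z - m *\<^sub>C S (V l z) = (V l z - l *\<^sub>C S (V l z)) - (m - l) *\<^sub>C S (V l z)"
      by (simp add: complex_vector.scale_left_diff_distrib)
    also have "\<dots> = x" using z(2) V_right[OF l, of z] by (simp add: algebra_simps)
    finally have "V m x = V l z" using V_left[OF m] by metis
    then show "V m x \<in> M" using VM z by simp
  qed
next
  fix l assume l: "l \<in> ball 0 \<rho>" and "\<not> (\<forall>x\<in>M. V l x \<in> M)"
  then obtain x where x: "x \<in> M" "V l x \<in> - M" by blast
  have "((\<lambda>m. V m x) \<longlongrightarrow> V l x) (nhds l)"
    using V_continuous[OF l] by (intro blinfun.tendsto tendsto_const) (simp add: tendsto_at_iff_tendsto_nhds)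
  then have "\<forall>\<^sub>F m in nhds l. V m x \<in> - M"
    using cl x by (auto dest: topological_tendstoD)
  then show "\<forall>\<^sub>F m in nhds l. m \<in> ball 0 \<rho> \<longrightarrow> \<not> (\<forall>x\<in>M. V m x \<in> M)"
    by eventually_elim (use x in auto)
qed (use l in auto)

end

section \<open>Regularity of the disc given by an inner inverse\<close>

context closed_operator begin

text \<open>Continuity of \<open>R T\<close> at \<open>0\<close> bounds it on a small ball of
  \<open>D\<close>, and homogeneity extends the bound to \<open>D\<close>.\<close>

lemma kernel_projection_bounded:
  assumes "generalized_inverse D T R"
  shows "\<exists>K. \<forall>x\<in>D. norm (x - R (T x)) \<le> K * norm x"
proof -
  have R: "R \<in> bounded_operators" "continuous_on D (\<lambda>x. R (T x))"
    using assms by (auto simp: generalized_inverse_def)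
  have 0: "0 \<in> D" by (rule complex_vector.subspace_0[OF D_subspace])
  obtain d where d: "d > 0" "\<And>x. x \<in> D \<Longrightarrow> norm x < d \<Longrightarrow> norm (R (T x)) < 1"
    using R(2) 0 unfolding continuous_on_iff by (force simp: dest: bspec[of D _ 0] spec[of _ 1])
  have "norm (R (T x)) \<le> 2 / d * norm x" if x: "x \<in> D" for x
  proof (cases "x = 0")
    case False
    define c where "c = complex_of_real (d / (2 * norm x))"
    have c: "cmod c = d / (2 * norm x)" using d by (simp add: c_def norm_divide norm_mult)
    have "norm (c *\<^sub>C x) < d" using False d by (simp add: norm_scaleC c)
    then have "norm (R (T (c *\<^sub>C x))) < 1" using d x complex_vector.subspace_scale[OF D_subspace] by blast
    then have "d / (2 * norm x) * norm (R (T x)) < 1"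
      using x by (simp add: T_scale bounded_operators_scaleC[OF R(1)] norm_scaleC c)
    then show ?thesis using False d by (simp add: field_simps)
  qed simp
  then have "norm (x - R (T x)) \<le> (1 + 2 / d) * norm x" if "x \<in> D" for x
    using that norm_triangle_ineq4[of x "R (T x)"] by (fastforce simp: algebra_simps)
  then show ?thesis by blast
qed

text \<open>
  For an inner inverse \<open>S\<close> the map \<open>S T\<close> may be discontinuous, so \<open>S V l\<close> itself need not be a
  generalized inverse; the family used is \<open>(I - Q) S V l\<close> with the bounded projection
  \<open>Q = V l P (I - l S)\<close> onto \<open>ker (T - l)\<close>.
\<close>

lemma ball_subset_reg:
  assumes reg: "0 \<in> reg D T" and S: "inner_inverse 0 S"
    and V: "\<And>l. l \<in> ball 0 \<rho> \<Longrightarrow> \<exists>V\<in>bounded_operators. \<forall>x. V (x - l *\<^sub>C S x) = x \<and> V x - l *\<^sub>C S (V x) = x"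
  shows "ball 0 \<rho> \<subseteq> reg D T"
proof -
  obtain V where "\<forall>l\<in>ball 0 \<rho>. V l \<in> bounded_operators \<and>
      (\<forall>x. V l (x - l *\<^sub>C S x) = x \<and> V l x - l *\<^sub>C S (V l x) = x)"
    using V by metis
  then interpret resolvent_family S V \<rho>
    using S by unfold_locales (auto simp: inner_inverse_def)
  obtain R0 where gi: "generalized_inverse D T R0"
    using reg unfolding reg_def by clarsimp (metis shift_0)
  have R0: "R0 \<in> bounded_operators" "R0 x \<in> D" "y \<in> D \<Longrightarrow> T (R0 (T y)) = T y"
    "continuous_on D (\<lambda>x. R0 (T x))" for x y
    using gi by (auto simp: generalized_inverse_def)
  have SD: "S u \<in> D" for u using S by (auto simp: inner_inverse_def)
  have TST: "T (S (T x)) = T x" if "x \<in> D" for x using S that by (simp add: inner_inverse_def)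
  note Dsub = complex_vector.subspace_diff[OF D_subspace] complex_vector.subspace_scale[OF D_subspace]
    complex_vector.subspace_add[OF D_subspace]
  \<comment> \<open>\<open>P\<close> projects \<open>D\<close> onto the kernel of \<open>T\<close>;
    its boundedness comes from the generalized inverse \<open>R0\<close>.\<close>
  define P where "P x = x - R0 (T x)" for x
  obtain K where K: "\<And>x. x \<in> D \<Longrightarrow> norm (P x) \<le> K * norm x"
    using kernel_projection_bounded[OF gi] by (auto simp: P_def)
  have P_ker: "P x \<in> D" "T (P x) = 0" if "x \<in> D" for x
    using that by (auto simp: P_def R0 Dsub T_diff)
  have P_id: "P y = y" if "T y = 0" for y using that by (simp add: P_def)
  have P_diff: "P (x - y) = P x - P y" if "x \<in> D" "y \<in> D" for x y
    using that by (simp add: P_def T_diff blinfun.diff_right)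
  have P_add: "P (x + y) = P x + P y" if "x \<in> D" "y \<in> D" for x y
    using that by (simp add: P_def T_add blinfun.add_right)
  have P_scale: "P (c *\<^sub>C x) = c *\<^sub>C P x" if "x \<in> D" for x c
    using that by (simp add: P_def T_scale bounded_operators_scaleC[OF R0(1)] complex_vector.scale_right_diff_distrib)
  have "bounded_linear (\<lambda>x. P (S x))"
  proof (rule bounded_linear_intro[where K = "max K 0 * norm S"])
    fix x
    have "norm (P (S x)) \<le> K * norm (S x)" using K SD by blast
    also have "\<dots> \<le> max K 0 * norm (S x)" by (intro mult_right_mono) auto
    also have "\<dots> \<le> max K 0 * (norm S * norm x)" by (intro mult_left_mono norm_blinfun) auto
    finally show "norm (P (S x)) \<le> norm x * (max K 0 * norm S)" by (simp add: mult_ac)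
  qed (auto simp: blinfun.add_right P_add SD scaleR_scaleC bounded_operators_scaleC[OF S_bo] P_scale)
  then obtain B where B: "\<And>x. blinfun_apply B x = P (S x)"
    using bounded_linear_Blinfun_apply by metis
  \<comment> \<open>This is \<open>(I - Q) S V l\<close>: since \<open>(I - l S) S V l = S\<close>,
    the term \<open>Q S V l\<close> equals \<open>V l P S\<close>. In this form \<open>l\<close>
    enters only through \<open>V l\<close>, which makes analyticity immediate.\<close>
  define R where "R l = (S o\<^sub>L V l) - (V l o\<^sub>L B)" for l
  have R: "R l x = S (V l x) - V l (P (S x))" for l x by (simp add: R_def blinfun.diff_left B)
  have "analytic_map R (ball 0 \<rho>)"
    unfolding analytic_map_def
  proof (intro ballI exI)
    fix l :: complex assume l: "l \<in> ball 0 \<rho>"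
    let ?W = "V l o\<^sub>L S o\<^sub>L V l"
    have "(R has_derivative (\<lambda>h. (S o\<^sub>L (h *\<^sub>C ?W)) - ((h *\<^sub>C ?W) o\<^sub>L B))) (at l)"
      unfolding R_def
      by (intro has_derivative_diff V_has_derivative[OF l]
        bounded_linear.has_derivative[OF bounded_bilinear.bounded_linear_right[OF bounded_bilinear_blinfun_compose]]
        bounded_linear.has_derivative[OF bounded_bilinear.bounded_linear_left[OF bounded_bilinear_blinfun_compose]])
    also have "(\<lambda>h. (S o\<^sub>L (h *\<^sub>C ?W)) - ((h *\<^sub>C ?W) o\<^sub>L B)) = (\<lambda>h. h *\<^sub>C ((S o\<^sub>L ?W) - (?W o\<^sub>L B)))"
      by (intro ext blinfun_eqI) (simp add: blinfun.diff_left scaleC_blinfun.rep_eq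
        bounded_operators_scaleC[OF S_bo] complex_vector.scale_right_diff_distrib)
    finally show "(R has_derivative (\<lambda>h. h *\<^sub>C ((S o\<^sub>L ?W) - (?W o\<^sub>L B)))) (at l)" .
  qed
  moreover have "generalized_inverse D (shift T l) (R l)" if l: "l \<in> ball 0 \<rho>" for l
  proof -
    note Vl = bounded_operators_scaleC[OF V_bo[OF l]]
    have VD: "V l x \<in> D" if "x \<in> D" for x
    proof -
      have "V l x = x + l *\<^sub>C S (V l x)" using V_right[OF l, of x] by (simp add: algebra_simps)
      then show ?thesis using that SD Dsub by metis
    qed
    have V_ker: "shift T l (V l y) = 0" if y: "y \<in> D" "T y = 0" for y
    proof -
      \<comment> \<open>On the stable set \<open>T S\<close> is the identity, so applying
        \<open>T\<close> to \<open>V l y = y + l S (V l y)\<close> gives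
        \<open>l V l y\<close>.\<close>
      have "V l y \<in> stable_set S"
        using V_invariant[OF stable_set_closed[OF S] stable_set_subspace[OF S] stable_set_invariant l]
          kernel_subset_stable_set[OF reg S y] by blast
      then have "T (S (V l y)) = V l y" unfolding stable_set_def by (auto dest: spec[of _ 0])
      moreover have "V l y = y + l *\<^sub>C S (V l y)" using V_right[OF l, of y] by (simp add: algebra_simps)
      then have "T (V l y) = T y + l *\<^sub>C T (S (V l y))"
        using y SD by (metis T_add T_scale Dsub(2))
      ultimately show ?thesis using y by (simp add: shift_def)
    qed
    define Q where "Q x = V l (P (x - l *\<^sub>C S x))" for x
    have QD: "Q x \<in> D" and Q_ker: "shift T l (Q x) = 0" if "x \<in> D" for x
      using that by (auto simp: Q_def intro!: VD V_ker P_ker Dsub SD)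
    \<comment> \<open>The reason is \<open>S (T - l) x = (I - l S) x - p\<close> with a kernel
      vector \<open>p\<close>, on which \<open>P\<close> is the identity.\<close>
    have RA: "R l (shift T l x) = x - Q x" if x: "x \<in> D" for x
    proof -
      define p where "p = x - S (T x)"
      have p: "p \<in> D" "T p = 0" using x SD TST by (auto simp: p_def T_diff Dsub)
      have y: "x - l *\<^sub>C S x \<in> D" using x SD by (intro Dsub)
      have SA: "S (shift T l x) = (x - l *\<^sub>C S x) - p" by (simp add: shift_def S_diff_scale p_def)
      have "S (V l (shift T l x)) = x - V l p"
        by (simp add: V_commute[OF l, symmetric] SA blinfun.diff_right[of _ "x - l *\<^sub>C S x"] V_left[OF l])
      moreover have "V l (P (S (shift T l x))) = Q x - V l p"
        by (simp add: SA P_diff[OF y p(1)] P_id[OF p(2)] Q_def blinfun.diff_right[of "V l"])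
      ultimately show ?thesis by (simp add: R)
    qed
    have RD: "R l x \<in> D" for x by (auto simp: R intro!: Dsub VD P_ker SD)
    \<comment> \<open>By \<open>RA\<close> this is \<open>R l (T - l) R l = R l\<close>.\<close>
    have "Q (R l x) = 0" for x
    proof -
      have "R l x - l *\<^sub>C S (R l x) = (S (V l x) - l *\<^sub>C S (S (V l x))) - (V l (P (S x)) - l *\<^sub>C S (V l (P (S x))))"
        by (simp add: R blinfun.diff_right complex_vector.scale_right_diff_distrib)
      also have "\<dots> = S x - P (S x)"
        using arg_cong[OF V_right[OF l, of x], of "blinfun_apply S"] V_right[OF l, of "P (S x)"]
        by (simp add: S_diff_scale)
      finally show ?thesis
        by (simp add: Q_def P_diff SD P_ker P_id)
    qed
    moreover have "continuous_on D (\<lambda>x. x - Q x)"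
    proof -
      have "continuous_on D P" unfolding P_def by (intro continuous_intros R0)
      then have "continuous_on D (\<lambda>x. P (x - l *\<^sub>C S x))"
      proof (rule continuous_on_compose2)
        show "continuous_on D (\<lambda>x. x - l *\<^sub>C S x)"
          by (intro continuous_on_diff continuous_on_id bounded_bilinear.continuous_on[OF bounded_bilinear_scaleC]
              blinfun.continuous_on continuous_on_const)
      qed (auto intro!: Dsub SD)
      then show ?thesis unfolding Q_def by (intro continuous_intros)
    qed
    then have "continuous_on D (\<lambda>x. R l (shift T l x))"
      by (simp add: RA cong: continuous_on_cong)
    moreover have "R l \<in> bounded_operators"
      by (auto simp: bounded_operators_def R Vl bounded_operators_scaleC[OF S_bo] P_scale SD
          complex_vector.scale_right_diff_distrib)
    \<comment> \<open>\<open>Q\<close> maps into the kernel at \<open>l\<close>, which gives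
      \<open>(T - l) R l (T - l) = T - l\<close> on \<open>D\<close>.\<close>
    moreover have "shift T l (x - Q x) = shift T l x" if "x \<in> D" for x
      using that QD Q_ker by (simp add: shift_diff)
    ultimately show ?thesis
      unfolding generalized_inverse_def using RD by (auto simp: RA)
  qed
  ultimately show ?thesis unfolding reg_def using open_ball by blast
qed

end

section \<open>The distance formula\<close>

context closed_operator begin

text \<open>\<open>\<phi>\<close> is the coordinate along \<open>e\<close> of the bounded projection
  \<open>x - R (T x)\<close> onto the kernel, in a basis containing \<open>e\<close>. It is bounded
  because the span \<open>G\<close> of the other basis vectors is finite-dimensional, hence closed,
  and does not contain \<open>e\<close>.\<close>

lemma functional_nonzero_on_kernel:
  assumes reg: "0 \<in> reg D T" and fin: "finite_dim {x \<in> D. T x = 0}"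
    and e: "e \<in> D" "T e = 0" "e \<noteq> 0"
  shows "\<exists>\<phi>. functional \<phi> \<and> \<phi> e \<noteq> 0"
proof -
  let ?N = "{x \<in> D. T x = 0}"
  obtain R where gi: "generalized_inverse D T R"
    using reg unfolding reg_def by clarsimp (metis shift_0)
  have R: "R \<in> bounded_operators" "R x \<in> D" "y \<in> D \<Longrightarrow> T (R (T y)) = T y" for x y
    using gi by (auto simp: generalized_inverse_def)
  obtain K where K: "\<And>x. x \<in> D \<Longrightarrow> norm (x - R (T x)) \<le> K * norm x"
    using kernel_projection_bounded[OF gi] by auto
  obtain B where B: "finite B" "cspan B = ?N" using fin by (auto simp: finite_dim_def)
  obtain A where A: "{e} \<subseteq> A" "A \<subseteq> ?N" "complex_vector.independent A" "?N \<subseteq> cspan A"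
    using complex_vector.maximal_independent_subset_extend[of "{e}" ?N] e by auto
  have "finite A" using complex_vector.independent_span_bound[OF B(1) A(3)] A(2) B(2) by blast
  define G where "G = cspan (A - {e})"
  have G: "closed G" "csubspace G"
    unfolding G_def using \<open>finite A\<close> by (auto intro: closed_cspan_finite)
  have eG: "e \<notin> G" using A by (auto simp: G_def complex_vector.dependent_def)
  obtain d where d: "d > 0" "\<And>f c. f \<in> G \<Longrightarrow> cmod c * d \<le> norm (f + c *\<^sub>C e)"
    using closed_csubspace_dist[OF G eG] by metis
  define \<phi> where "\<phi> x = (SOME k. x - R (T x) - k *\<^sub>C e \<in> G)" for x
  have \<phi>: "x - R (T x) - \<phi> x *\<^sub>C e \<in> G" if "x \<in> D" for x
  proof -
    have "x - R (T x) \<in> ?N"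
      using that R by (auto simp: T_diff complex_vector.subspace_diff[OF D_subspace])
    then have "\<exists>k. x - R (T x) - k *\<^sub>C e \<in> G"
      unfolding G_def using A by (intro complex_vector.span_breakdown) auto
    then show ?thesis unfolding \<phi>_def by (rule someI_ex)
  qed
  have uniq: "\<phi> x = k" if "x \<in> D" "x - R (T x) - k *\<^sub>C e \<in> G" for x k
  proof -
    have "(x - R (T x) - \<phi> x *\<^sub>C e) - (x - R (T x) - k *\<^sub>C e) \<in> G"
      by (rule complex_vector.subspace_diff[OF G(2) \<phi>[OF that(1)] that(2)])
    then have "cmod (\<phi> x - k) * d \<le>
        norm (((x - R (T x) - \<phi> x *\<^sub>C e) - (x - R (T x) - k *\<^sub>C e)) + (\<phi> x - k) *\<^sub>C e)"
      by (rule d(2))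
    also have "\<dots> = 0" by (simp add: complex_vector.scale_left_diff_distrib)
    finally show ?thesis using d by (simp add: mult_le_0_iff)
  qed
  have "functional \<phi>"
    unfolding functional_def
  proof (intro conjI ballI allI exI[of _ "K / d"])
    fix x assume x: "x \<in> D"
    show "\<phi> (c *\<^sub>C x) = c * \<phi> x" for c
    proof (rule uniq)
      have "c *\<^sub>C (x - R (T x) - \<phi> x *\<^sub>C e) \<in> G"
        using \<phi>[OF x] by (rule complex_vector.subspace_scale[OF G(2)])
      then show "c *\<^sub>C x - R (T (c *\<^sub>C x)) - (c * \<phi> x) *\<^sub>C e \<in> G"
        using x by (simp add: T_scale bounded_operators_scaleC[OF R(1)] scaleC_scaleC
            complex_vector.scale_right_diff_distrib)
    qed (use x complex_vector.subspace_scale[OF D_subspace] in auto)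
    show "\<phi> (x + y) = \<phi> x + \<phi> y" if y: "y \<in> D" for y
    proof (rule uniq)
      have "(x - R (T x) - \<phi> x *\<^sub>C e) + (y - R (T y) - \<phi> y *\<^sub>C e) \<in> G"
        by (rule complex_vector.subspace_add[OF G(2) \<phi>[OF x] \<phi>[OF y]])
      also have "(x - R (T x) - \<phi> x *\<^sub>C e) + (y - R (T y) - \<phi> y *\<^sub>C e) =
          x + y - R (T (x + y)) - (\<phi> x + \<phi> y) *\<^sub>C e"
        using x y by (simp add: T_add blinfun.add_right scaleC_add_left)
      finally show "x + y - R (T (x + y)) - (\<phi> x + \<phi> y) *\<^sub>C e \<in> G" .
    qed (use x y complex_vector.subspace_add[OF D_subspace] in auto)
    have "cmod (\<phi> x) * d \<le> norm ((x - R (T x) - \<phi> x *\<^sub>C e) + \<phi> x *\<^sub>C e)"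
      by (intro d \<phi> x)
    also have "\<dots> \<le> K * norm x" using K[OF x] by simp
    finally show "cmod (\<phi> x) \<le> K / d * norm x" using d by (simp add: field_simps)
  qed
  moreover have "\<phi> e = 1"
    using e complex_vector.subspace_0[OF G(2)] by (intro uniq) (auto simp: scaleC_one)
  ultimately show ?thesis by (intro exI[of _ \<phi>]) simp
qed

lemma inner_inverses_into_domain:
  assumes "ball 0 \<rho> \<subseteq> reg D T"
  shows "inner_inverses_into D \<rho>"
  unfolding inner_inverses_into_def
proof (intro conjI ballI D_subspace subset_refl)
  fix l :: complex assume "l \<in> ball 0 \<rho>"
  then have "l \<in> reg D T" using assms by blast
  then obtain V R where V: "open V" "l \<in> V" "analytic_map R V"
    and gi: "\<And>m. m \<in> V \<Longrightarrow> generalized_inverse D (shift T m) (R m)"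
    unfolding reg_def by blast
  obtain d where "(R has_derivative (\<lambda>h. h *\<^sub>C d)) (at l)"
    using V unfolding analytic_map_def by blast
  then have "isCont R l" by (rule has_derivative_continuous)
  then have "(R \<longlongrightarrow> R l) (nhds l)" by (simp add: continuous_at tendsto_at_iff_tendsto_nhds)
  then have "((\<lambda>m. norm (R m)) \<longlongrightarrow> norm (R l)) (nhds l)" by (rule tendsto_norm)
  then have "\<forall>\<^sub>F m in nhds l. norm (R m) < norm (R l) + 1" by (rule order_tendstoD) simp
  moreover have "\<forall>\<^sub>F m in nhds l. m \<in> V" using V by (intro eventually_nhds_in_open)
  ultimately have "\<forall>\<^sub>F m in nhds l. \<exists>S. inner_inverse m S \<and> range (blinfun_apply S) \<subseteq> D \<and> norm S \<le> norm (R l) + 1"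
  proof eventually_elim
    case (elim m)
    then show ?case
      using generalized_inverse_imp_inner_inverse[OF gi[of m]]
      by (intro exI[of _ "R m"]) (auto simp: inner_inverse_def)
  qed
  then show "\<exists>C. \<forall>\<^sub>F m in nhds l. \<exists>S. inner_inverse m S \<and> range (blinfun_apply S) \<subseteq> D \<and> norm S \<le> C" ..
qed

text \<open>\<open>kernel_stage\<close> shrinks the domain to a common complement \<open>D'\<close>
  of the kernels, \<open>range_stage\<close> then provides \<open>N\<close>, both over discs larger
  than \<open>ball 0 r\<close>.\<close>

lemma exists_inner_inverse_with_resolvent:
  assumes fred: "fredholm D T" and \<rho>: "ball 0 \<rho> \<subseteq> reg D T" and r: "0 < r" "r < \<rho>"
  shows "\<exists>S. inner_inverse 0 S \<and> (\<forall>l\<in>ball 0 r. \<exists>V\<in>bounded_operators.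
      \<forall>x. V (x - l *\<^sub>C S x) = x \<and> V x - l *\<^sub>C S (V x) = x)"
proof -
  have reg: "0 \<in> reg D T" using \<rho> r by auto
  have fin: "finite_dim {x \<in> D. T x = 0}" using fred by (simp add: fredholm_def)
  then obtain B where B: "finite B" "cspan B = {x \<in> D. T x = 0}" by (auto simp: finite_dim_def)
  obtain D' \<rho>' where D': "r < \<rho>'" "inner_inverses_into D' \<rho>'" "\<forall>x\<in>D'. T x = 0 \<longrightarrow> x = 0"
    using kernel_stage[OF functional_nonzero_on_kernel[OF reg fin]
        complex_vector.independent_span_bound[OF B(1)] inner_inverses_into_domain[OF \<rho>] r]
    unfolding B(2) by blast
  \<comment> \<open>An inner inverse with values in \<open>D'\<close> shows that \<open>T\<close>
    has the same range on \<open>D'\<close> as on \<open>D\<close>, so its finite codimension is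
    kept.\<close>
  have "\<exists>S. inner_inverse 0 S \<and> range (blinfun_apply S) \<subseteq> D'"
  proof -
    have "0 \<in> ball 0 \<rho>'" using D' r by simp
    then obtain C where C: "\<forall>\<^sub>F m in nhds 0. \<exists>S. inner_inverse m S \<and>
          range (blinfun_apply S) \<subseteq> D' \<and> norm S \<le> C"
      using D'(2) unfolding inner_inverses_into_def by blast
    then show ?thesis using eventually_nhds_x_imp_x by blast
  qed
  then obtain S where "inner_inverse 0 S" "range (blinfun_apply S) \<subseteq> D'" by blast
  then have "S (T x) \<in> D'" "T (S (T x)) = T x" if "x \<in> D" for x
    using that by (auto simp: inner_inverse_def)
  then have range: "T ` D \<subseteq> T ` D'" by (metis image_eqI image_subsetI)
  obtain F where F: "finite F" "\<And>x. \<exists>b\<in>cspan F. x - b \<in> T ` D"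
    using fred by (auto simp: fredholm_def finite_codim_def)
  have "T ` D' = range_plus D' {0} 0" by (auto simp: range_plus_def)
  then have F': "\<exists>b\<in>cspan F. x - b \<in> range_plus D' {0} 0" for x using F(2) range by blast
  obtain N \<rho>'' where "r < \<rho>''" "transversal D' N \<rho>''" "range_plus D' N 0 = UNIV"
    using range_stage[OF F(1) order_refl F' transversal_start[OF D'(2,3)] r(1) D'(1)] by blast
  then show ?thesis
    using inner_inverse_with_resolvent[of D' N \<rho>''] range r by force
qed

end

text \<open>Since \<open>I - l S = - l (S - inverse l I)\<close>, the two inverses correspond
  through \<open>V = - inverse l R\<close> and \<open>R = - l V\<close>.\<close>

lemma op_spectrum_iff_resolvent:
  assumes S: "S \<in> bounded_operators" and l: "l \<noteq> 0"
  shows "inverse l \<notin> op_spectrum S \<longleftrightarrow>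
    (\<exists>V\<in>bounded_operators. \<forall>x. V (x - l *\<^sub>C S x) = x \<and> V x - l *\<^sub>C S (V x) = x)"
proof
  note simps = scaleC_blinfun.rep_eq blinfun.diff_left blinfun.diff_right blinfun.minus_left
    blinfun.minus_right scaleC_scaleC scaleC_one complex_vector.scale_right_diff_distrib
    complex_vector.scale_minus_left
  have scale_bo: "c *\<^sub>C R \<in> bounded_operators" if "R \<in> bounded_operators" for c and R :: "'a \<Rightarrow>\<^sub>L 'a"
    using that by (simp add: bounded_operators_def scaleC_blinfun.rep_eq scaleC_scaleC mult.commute)
  note Ss = bounded_operators_scaleC[OF S]
  {
    assume "inverse l \<notin> op_spectrum S"
    then obtain R where R: "R \<in> bounded_operators"
      "R o\<^sub>L (S - inverse l *\<^sub>C id_blinfun) = id_blinfun" "(S - inverse l *\<^sub>C id_blinfun) o\<^sub>L R = id_blinfun"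
      unfolding op_spectrum_def by blast
    note Rs = bounded_operators_scaleC[OF R(1)]
    have 1: "R (S x) - inverse l *\<^sub>C R x = x" for x
      using arg_cong[OF R(2), of "\<lambda>f. blinfun_apply f x"] by (simp add: simps Rs)
    have 2: "S (R x) - inverse l *\<^sub>C R x = x" for x
      using arg_cong[OF R(3), of "\<lambda>f. blinfun_apply f x"] by (simp add: simps)
    show "\<exists>V\<in>bounded_operators. \<forall>x. V (x - l *\<^sub>C S x) = x \<and> V x - l *\<^sub>C S (V x) = x"
    proof (intro bexI allI conjI)
      show "((- inverse l) *\<^sub>C R) \<in> bounded_operators" by (rule scale_bo[OF R(1)])
      fix x
      show "((- inverse l) *\<^sub>C R) (x - l *\<^sub>C S x) = x"
        using 1[of x] l by (simp add: simps Rs)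
      show "((- inverse l) *\<^sub>C R) x - l *\<^sub>C S (((- inverse l) *\<^sub>C R) x) = x"
        using 2[of x] l by (simp add: simps Ss)
    qed
  next
    assume "\<exists>V\<in>bounded_operators. \<forall>x. V (x - l *\<^sub>C S x) = x \<and> V x - l *\<^sub>C S (V x) = x"
    then obtain V where V: "V \<in> bounded_operators" "\<And>x. V (x - l *\<^sub>C S x) = x"
      "\<And>x. V x - l *\<^sub>C S (V x) = x" by blast
    note Vs = bounded_operators_scaleC[OF V(1)]
    have "((- l) *\<^sub>C V) o\<^sub>L (S - inverse l *\<^sub>C id_blinfun) = id_blinfun"
    proof (rule blinfun_eqI)
      fix x
      show "(((- l) *\<^sub>C V) o\<^sub>L (S - inverse l *\<^sub>C id_blinfun)) x = id_blinfun x"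
        using V(2)[of x] l by (simp add: simps Vs)
    qed
    moreover have "(S - inverse l *\<^sub>C id_blinfun) o\<^sub>L ((- l) *\<^sub>C V) = id_blinfun"
    proof (rule blinfun_eqI)
      fix x
      show "((S - inverse l *\<^sub>C id_blinfun) o\<^sub>L ((- l) *\<^sub>C V)) x = id_blinfun x"
        using V(3)[of x] l by (simp add: simps Ss)
    qed
    ultimately show "inverse l \<notin> op_spectrum S"
      unfolding op_spectrum_def using scale_bo[OF V(1)] by blast
  }
qed

lemma one_divide_antimono_ennreal:
  fixes x y :: ennreal
  assumes "x \<le> y"
  shows "1 / y \<le> 1 / x"
proof (cases "x = 0 \<or> y = top")
  case True
  then show ?thesis by (auto simp: divide_ennreal_def)
next
  case False
  then obtain a b where ab: "x = ennreal a" "y = ennreal b" "0 \<le> a" "0 \<le> b"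
    using assms by (cases x; cases y) (auto simp: top_unique)
  then have "0 < a" "a \<le> b" using False assms by (auto simp: less_le)
  then show ?thesis using ab
    by (simp add: divide_ennreal_def inverse_ennreal le_imp_inverse_le)
qed

theorem theorem3p1:
  fixes D :: "'a::complex_banach set" and T :: "'a \<Rightarrow> 'a"
  assumes "closed_densely_defined D T"
    and "0 \<in> rho_e_r D T"
  shows "dist_to_set 0 (generalized_spectrum D T) =
    (SUP S \<in> {S \<in> bounded_operators. range (blinfun_apply S) \<subseteq> D \<and>
                (\<forall>x\<in>D. T (blinfun_apply S (T x)) = T x)}.
       1 / spectral_radius S)"
    (is "?d = (SUP S \<in> ?I. _)")
proof -
  interpret closed_operator D T by unfold_locales fact
  have reg: "0 \<in> reg D T" and fred: "fredholm D T"
    using assms(2) by (auto simp: rho_e_r_def rho_e_def)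
  have I: "?I = {S. inner_inverse 0 S}" by (auto simp: inner_inverse_def)
  show ?thesis
    unfolding I
  proof (rule antisym)
    show "(SUP S \<in> {S. inner_inverse 0 S}. 1 / spectral_radius S) \<le> ?d"
    proof (rule SUP_least)
      fix S assume "S \<in> {S. inner_inverse 0 S}"
      then have S: "inner_inverse 0 S" and S_bo: "S \<in> bounded_operators"
        by (auto simp: inner_inverse_def)
      show "1 / spectral_radius S \<le> ?d"
        unfolding dist_to_set_def
      proof (rule INF_greatest, rule ccontr)
        fix y assume y: "y \<in> generalized_spectrum D T" and "\<not> 1 / spectral_radius S \<le> ennreal (dist 0 y)"
        then have "ennreal (cmod y) < 1 / spectral_radius S" by simp
        \<comment> \<open>A finite radius strictly between \<open>cmod y\<close> and
          \<open>1 / spectral_radius S\<close>, which may be infinite.\<close>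
        then obtain t where t: "ennreal (cmod y) < t" "t < 1 / spectral_radius S" using dense by blast
        then have "t \<noteq> top" by auto
        then obtain \<rho> where \<rho>: "t = ennreal \<rho>" "0 \<le> \<rho>" by (cases t) auto
        have "ball 0 \<rho> \<subseteq> reg D T"
        proof (rule ball_subset_reg[OF reg S])
          fix l :: complex assume l: "l \<in> ball 0 \<rho>"
          show "\<exists>V\<in>bounded_operators. \<forall>x. V (x - l *\<^sub>C S x) = x \<and> V x - l *\<^sub>C S (V x) = x"
          proof (cases "l = 0")
            case True
            then show ?thesis by (intro bexI[of _ id_blinfun]) (auto simp: bounded_operators_def)
          next
            case False
            have "inverse l \<notin> op_spectrum S"
            proof
              assume "inverse l \<in> op_spectrum S"
              then have "ennreal (cmod (inverse l)) \<le> spectral_radius S"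
                unfolding spectral_radius_def by (rule SUP_upper)
              then have "1 / spectral_radius S \<le> 1 / ennreal (cmod (inverse l))"
                by (rule one_divide_antimono_ennreal)
              also have "\<dots> = ennreal (cmod l)"
                using False by (simp add: norm_inverse norm_divide divide_ennreal inverse_eq_divide flip: ennreal_1)
              also have "\<dots> \<le> ennreal \<rho>" using l by (intro ennreal_leI) simp
              finally show False using t \<rho> by simp
            qed
            then show ?thesis using op_spectrum_iff_resolvent[OF S_bo False] by simp
          qed
        qed
        moreover have "y \<in> ball 0 \<rho>" using t \<rho> by (simp add: ennreal_less_iff)
        ultimately show False using y by (auto simp: generalized_spectrum_def)
      qed
    qed
    show "?d \<le> (SUP S \<in> {S. inner_inverse 0 S}. 1 / spectral_radius S)"
    proof (rule dense_le)
      fix t assume t: "t < ?d"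
      then have "t \<noteq> top" by auto
      then obtain r where r: "t = ennreal r" "0 \<le> r" by (cases t) auto
      show "t \<le> (SUP S \<in> {S. inner_inverse 0 S}. 1 / spectral_radius S)"
      proof (cases "r = 0")
        case False
        then have "0 < r" using r by simp
        \<comment> \<open>The construction of \<open>S\<close> uses a regular disc strictly larger
          than \<open>ball 0 r\<close>; \<open>u\<close> supplies its radius.\<close>
        obtain u where u: "t < u" "u < ?d" using dense t by blast
        then have "u \<noteq> top" by auto
        then obtain \<rho> where \<rho>: "u = ennreal \<rho>" "0 \<le> \<rho>" by (cases u) auto
        have "r < \<rho>" using u r \<rho> by (simp add: ennreal_less_iff)
        have "ball 0 \<rho> \<subseteq> reg D T"
        proof
          fix l :: complex assume l: "l \<in> ball 0 \<rho>"
          show "l \<in> reg D T"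
          proof (rule ccontr)
            assume "l \<notin> reg D T"
            then have "?d \<le> ennreal (dist 0 l)"
              unfolding dist_to_set_def by (intro INF_lower) (simp add: generalized_spectrum_def)
            also have "\<dots> \<le> ennreal \<rho>" using l by (intro ennreal_leI) simp
            finally show False using u \<rho> by simp
          qed
        qed
        then obtain S where S: "inner_inverse 0 S" and V: "\<And>l. l \<in> ball 0 r \<Longrightarrow> \<exists>V\<in>bounded_operators.
            \<forall>x. V (x - l *\<^sub>C S x) = x \<and> V x - l *\<^sub>C S (V x) = x"
          using exists_inner_inverse_with_resolvent[OF fred _ \<open>0 < r\<close> \<open>r < \<rho>\<close>] by blast
        have S_bo: "S \<in> bounded_operators" using S by (simp add: inner_inverse_def)
        have "spectral_radius S \<le> ennreal (1 / r)"
          unfolding spectral_radius_def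
        proof (intro SUP_least ennreal_leI, rule ccontr)
          \<comment> \<open>For such a \<open>z\<close> the reciprocal lies in
            \<open>ball 0 r\<close>, where \<open>I - l S\<close> is invertible.\<close>
          fix z assume z: "z \<in> op_spectrum S" "\<not> cmod z \<le> 1 / r"
          then have "cmod z > 0" using \<open>0 < r\<close> by (meson less_trans not_le zero_less_divide_1_iff)
          then have "inverse z \<noteq> 0" by auto
          moreover have "inverse z \<in> ball 0 r"
            using z \<open>0 < r\<close> \<open>cmod z > 0\<close> by (simp add: norm_inverse norm_divide field_simps)
          ultimately have "inverse (inverse z) \<notin> op_spectrum S"
            using V op_spectrum_iff_resolvent[OF S_bo] by blast
          then show False using z by simp
        qed
        then have "1 / ennreal (1 / r) \<le> 1 / spectral_radius S" by (rule one_divide_antimono_ennreal)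
        moreover have "1 / ennreal (1 / r) = t"
          using \<open>0 < r\<close> r by (simp add: divide_ennreal flip: ennreal_1)
        ultimately show ?thesis using S by (metis (mono_tags) SUP_upper2 mem_Collect_eq)
      qed (use r in simp)
    qed
  qed
qed

end
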